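(* Let $(L,[\cdot,\cdot],\{\cdot,\cdot\},\alpha)$ be a compatible Hom-Leibniz algebra, and put $\pi_1(x,y)=[x,y]$, $\pi_2(x,y)=\{x,y\}$. For $n\ge1$ let $LC_\alpha^n(L,L)=\mathbb C_\alpha^n(L,L)\oplus\cdots\oplus\mathbb C_\alpha^n(L,L)$ ($n$ copies), and define $d^n:LC_\alpha^n(L,L)\to LC_\alpha^{n+1}(L,L)$ by $$d^1f=([\pi_1,f]_B,[\pi_2,f]_B),$$ and, for $n\ge2$, $d^n(f_1,\dots,f_n)=(-1)^{n-1}(g_1,\dots,g_{n+1})$, where $g_1=[\pi_1,f_1]_B$, $g_i=[\pi_2,f_{i-1}]_B+[\pi_1,f_i]_B$ for $2\le i\le n$, and $g_{n+1}=[\pi_2,f_n]_B$. Then $d^{n+1}\circ d^n=0$ for all $n\ge1$.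
   Context: $K$ is a field of characteristic $0$. Hom-Leibniz algebra: a triple $(L,[\cdot,\cdot],\alpha)$ with $L$ a $K$-vector space, $[\cdot,\cdot]:L\otimes L\to L$ and $\alpha:L\to L$ linear, such that $[\alpha(x),[y,z]]=[[x,y],\alpha(z)]+[\alpha(y),[x,z]]$ for all $x,y,z\in L$. All Hom-Leibniz algebras are assumed multiplicative: $\alpha([x,y])=[\alpha(x),\alpha(y)]$. Compatible Hom-Leibniz algebra: a quadruple $(L,[\cdot,\cdot],\{\cdot,\cdot\},\alpha)$ such that $(L,[\cdot,\cdot],\alpha)$ and $(L,\{\cdot,\cdot\},\alpha)$ are Hom-Leibniz algebras and for all $x,y,z\in L$ $$[\alpha(x),\{y,z\}]+\{\alpha(x),[y,z]\}=[\{x,y\},\alpha(z)]+\{[x,y],\alpha(z)\}+[\alpha(y),\{x,z\}]+\{\alpha(y),[x,z]\}.$$ Cochains: for $n\ge1$, $\mathbb C_\alpha^n(L,L)=\{f\in \mathrm{Hom}(L^{\otimes n},L)\mid \alpha\circ f=f\circ\alpha^{\otimes n}\}$, and $\mathbb C_\alpha^*(L,L)=\bigoplus_{n\ge1}\mathbb C_\alpha^n(L,L)$, where elements of $\mathbb C_\alpha^n(L,L)$ have degree $n-1$. Balavoine bracket: for $P\in\mathbb C_\alpha^{p+1}(L,L)$, $Q\in\mathbb C_\alpha^{q+1}(L,L)$, $[P,Q]_B=P\circ Q-(-1)^{pq}Q\circ P$, where $P\circ Q=\sum_{k=1}^{p+1}(-1)^{(k-1)q}P\circ_kQ\in \mathbb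 C_\alpha^{p+q+1}(L,L)$ and $$(P\circ_kQ)(x_1,\dots,x_{p+q+1})=\sum_{\sigma\in S_{(k-1,q)}}(-1)^\sigma P\big(\alpha^q(x_{\sigma(1)}),\dots,\alpha^q(x_{\sigma(k-1)}),Q(x_{\sigma(k)},\dots,x_{\sigma(k+q-1)},x_{k+q}),\alpha^q(x_{k+q+1}),\dots,\alpha^q(x_{p+q+1})\big).$$ Here $S_{(i,n-i)}$ is the set of $\sigma\in S_n$ with $\sigma(1)<\dots<\sigma(i)$ and $\sigma(i+1)<\dots<\sigma(n)$ (only the identity if $i=0$ or $i=n$), and $(-1)^\sigma$ is the sign. It is known that $(\mathbb C_\alpha^*(L,L),[\cdot,\cdot]_B)$ is a graded Lie algebra. *)

theory Defs
  imports Complex_Main "HOL-Library.FuncSet" "HOL-Combinatorics.Permutations"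
begin

locale hom_leibniz = vector_space scale
  for scale :: "'k::field_char_0 \<Rightarrow> 'v::ab_group_add \<Rightarrow> 'v" +
  fixes br :: "'v \<Rightarrow> 'v \<Rightarrow> 'v" and \<alpha> :: "'v \<Rightarrow> 'v"
  assumes linear_alpha: "Vector_Spaces.linear scale scale \<alpha>"
    and linear_br_left: "\<And>y. Vector_Spaces.linear scale scale (\<lambda>x. br x y)"
    and linear_br_right: "\<And>x. Vector_Spaces.linear scale scale (\<lambda>y. br x y)"
    and multiplicative: "\<And>x y. \<alpha> (br x y) = br (\<alpha> x) (\<alpha> y)"
    and hom_leibniz_identity:
      "\<And>x y z. br (\<alpha> x) (br y z) = br (br x y) (\<alpha> z) + br (\<alpha> y) (br x z)"

locale compatible_hom_leibniz =
  first: hom_leibniz scale br1 \<alpha> + second: hom_leibniz scale br2 \<alpha>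
  for scale :: "'k::field_char_0 \<Rightarrow> 'v::ab_group_add \<Rightarrow> 'v"
    and br1 br2 :: "'v \<Rightarrow> 'v \<Rightarrow> 'v" and \<alpha> :: "'v \<Rightarrow> 'v" +
  assumes compatibility:
    "\<And>x y z. br1 (\<alpha> x) (br2 y z) + br2 (\<alpha> x) (br1 y z) =
       br1 (br2 x y) (\<alpha> z) + br2 (br1 x y) (\<alpha> z) +
       br1 (\<alpha> y) (br2 x z) + br2 (\<alpha> y) (br1 x z)"

text \<open>
  An element of \<open>Hom(L\<^sup>\<otimes>\<^sup>n, L)\<close> is represented as a multilinear map in the arguments
  \<open>x 1, \<dots>, x n\<close> of a sequence \<open>x\<close>. As such a map depends on these entries only, two of them
  agree as maps on \<open>L\<^sup>n\<close> exactly if they are equal as HOL functions.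
\<close>

definition multilinear_maps ::
  "('k::field_char_0 \<Rightarrow> 'v::ab_group_add \<Rightarrow> 'v) \<Rightarrow> nat \<Rightarrow> ((nat \<Rightarrow> 'v) \<Rightarrow> 'v) set" where
  "multilinear_maps scale n =
     {f. (\<forall>x y. (\<forall>i\<in>{1..n}. x i = y i) \<longrightarrow> f x = f y) \<and>
         (\<forall>x. \<forall>i\<in>{1..n}. Vector_Spaces.linear scale scale (\<lambda>v. f (x(i := v))))}"

definition cochains ::
  "('k::field_char_0 \<Rightarrow> 'v::ab_group_add \<Rightarrow> 'v) \<Rightarrow> ('v \<Rightarrow> 'v) \<Rightarrow> nat \<Rightarrow> ((nat \<Rightarrow> 'v) \<Rightarrow> 'v) set" where
  "cochains scale \<alpha> n =
     {f \<in> multilinear_maps scale n. \<forall>x. \<alpha> (f x) = f (\<lambda>i. \<alpha> (x i))}"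

definition shuffle_perms :: "nat \<Rightarrow> nat \<Rightarrow> (nat \<Rightarrow> nat) set" where
  "shuffle_perms i n =
     {\<sigma>. \<sigma> permutes {1..n} \<and> strict_mono_on {1..i} \<sigma> \<and> strict_mono_on {i+1..n} \<sigma>}"

text \<open>
  Below, \<open>p\<close> and \<open>q\<close> are the degrees of \<open>P\<close> and \<open>Q\<close>, which have \<open>p + 1\<close> and \<open>q + 1\<close> arguments.
  They are parameters because the arity cannot be recovered from a cochain (the zero cochain
  lies in every degree).
\<close>

definition partial_comp ::
  "('k::field_char_0 \<Rightarrow> 'v::ab_group_add \<Rightarrow> 'v) \<Rightarrow> ('v \<Rightarrow> 'v) \<Rightarrow> nat \<Rightarrow> nat \<Rightarrow>
   ((nat \<Rightarrow> 'v) \<Rightarrow> 'v) \<Rightarrow> ((nat \<Rightarrow> 'v) \<Rightarrow> 'v) \<Rightarrow> (nat \<Rightarrow> 'v) \<Rightarrow> 'v" where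
  "partial_comp scale \<alpha> q k P Q x =
     (\<Sum>\<sigma>\<in>shuffle_perms (k - 1) (k - 1 + q). scale (of_int (sign \<sigma>))
        (P (\<lambda>i. if i < k then (\<alpha> ^^ q) (x (\<sigma> i))
                else if i = k then
                  Q (\<lambda>j. if j \<le> q then x (\<sigma> (k - 1 + j)) else x (k + q))
                else (\<alpha> ^^ q) (x (i + q)))))"

definition circ ::
  "('k::field_char_0 \<Rightarrow> 'v::ab_group_add \<Rightarrow> 'v) \<Rightarrow> ('v \<Rightarrow> 'v) \<Rightarrow> nat \<Rightarrow> nat \<Rightarrow>
   ((nat \<Rightarrow> 'v) \<Rightarrow> 'v) \<Rightarrow> ((nat \<Rightarrow> 'v) \<Rightarrow> 'v) \<Rightarrow> (nat \<Rightarrow> 'v) \<Rightarrow> 'v" where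
  "circ scale \<alpha> p q P Q x =
     (\<Sum>k = 1..p + 1. scale ((- 1) ^ ((k - 1) * q)) (partial_comp scale \<alpha> q k P Q x))"

definition balavoine_bracket ::
  "('k::field_char_0 \<Rightarrow> 'v::ab_group_add \<Rightarrow> 'v) \<Rightarrow> ('v \<Rightarrow> 'v) \<Rightarrow> nat \<Rightarrow> nat \<Rightarrow>
   ((nat \<Rightarrow> 'v) \<Rightarrow> 'v) \<Rightarrow> ((nat \<Rightarrow> 'v) \<Rightarrow> 'v) \<Rightarrow> (nat \<Rightarrow> 'v) \<Rightarrow> 'v" where
  "balavoine_bracket scale \<alpha> p q P Q x =
     circ scale \<alpha> p q P Q x - scale ((- 1) ^ (p * q)) (circ scale \<alpha> q p Q P x)"

definition bracket_cochain :: "('v \<Rightarrow> 'v \<Rightarrow> 'v) \<Rightarrow> (nat \<Rightarrow> 'v) \<Rightarrow> 'v" where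
  "bracket_cochain br x = br (x 1) (x 2)"

definition LC ::
  "('k::field_char_0 \<Rightarrow> 'v::ab_group_add \<Rightarrow> 'v) \<Rightarrow> ('v \<Rightarrow> 'v) \<Rightarrow> nat \<Rightarrow>
   (nat \<Rightarrow> (nat \<Rightarrow> 'v) \<Rightarrow> 'v) set" where
  "LC scale \<alpha> n = {1..n} \<rightarrow>\<^sub>E cochains scale \<alpha> n"

definition LC_zero :: "nat \<Rightarrow> nat \<Rightarrow> (nat \<Rightarrow> 'v) \<Rightarrow> 'v::ab_group_add" where
  "LC_zero n = (\<lambda>i\<in>{1..n}. \<lambda>x. 0)"

text \<open>
  For \<open>n = 1\<close> the middle case is void and the sign is \<open>1\<close>, so that
  \<open>d\<^sup>1 f = ([\<pi>\<^sub>1, f], [\<pi>\<^sub>2, f])\<close>. An \<open>n\<close>-cochain has degree \<open>n - 1\<close>, a bracket has degree \<open>1\<close>.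
\<close>

definition compat_d ::
  "('k::field_char_0 \<Rightarrow> 'v::ab_group_add \<Rightarrow> 'v) \<Rightarrow> ('v \<Rightarrow> 'v \<Rightarrow> 'v) \<Rightarrow> ('v \<Rightarrow> 'v \<Rightarrow> 'v) \<Rightarrow>
   ('v \<Rightarrow> 'v) \<Rightarrow> nat \<Rightarrow> (nat \<Rightarrow> (nat \<Rightarrow> 'v) \<Rightarrow> 'v) \<Rightarrow> nat \<Rightarrow> (nat \<Rightarrow> 'v) \<Rightarrow> 'v" where
  "compat_d scale br1 br2 \<alpha> n f =
     (let B1 = balavoine_bracket scale \<alpha> 1 (n - 1) (bracket_cochain br1);
          B2 = balavoine_bracket scale \<alpha> 1 (n - 1) (bracket_cochain br2);
          g = (\<lambda>i x. if i = 1 then B1 (f 1) x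
                     else if i = n + 1 then B2 (f n) x
                     else B2 (f (i - 1)) x + B1 (f i) x)
      in (\<lambda>i\<in>{1..n + 1}. \<lambda>x. scale ((- 1) ^ (n - 1)) (g i x)))"

end

theory Submission
  imports Defs
begin

text \<open>
  Compatibility says exactly that \<open>\<pi>\<^sub>1 + \<pi>\<^sub>2\<close> is again a Hom-Leibniz product, so by polarization
  everything follows from \<open>[\<pi>, [\<pi>, f]] = 0\<close> for a single Hom-Leibniz product \<open>\<pi>\<close>. The graded
  Jacobi identity is not needed for this: up to sign, \<open>[\<pi>, f]\<close> is the Loday-Pirashvili
  coboundary \<open>\<delta> f\<close>. Let \<open>\<iota>\<^sub>y\<close> be the insertion of \<open>y\<close> into the first slot and \<open>L\<^sub>y\<close> the
  action of \<open>y\<close> on cochains. The Leibniz identity gives \<open>[L\<^sub>x, L\<^sub>y] = L\<^bsub>[x,y]\<^esub>\<close>; with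
  \<open>\<iota>\<^sub>y \<delta> = - L\<^sub>y - \<delta> \<iota>\<^sub>y\<close>, induction on the arity then yields first \<open>L\<^sub>x \<delta> = \<delta> L\<^sub>x\<close> and
  then \<open>\<delta> \<delta> = 0\<close> (all up to twists by \<open>\<alpha>\<close>).
\<close>

section \<open>Sequences split into head and tail: \<open>case_nat a z\<close> has entry
  \<open>a\<close> at 0, followed by \<open>z\<close>\<close>

lemma case_nat_upd_0: "(case_nat a z)(0 := v) = case_nat v z"
  by (auto simp: fun_eq_iff split: nat.split)

lemma case_nat_upd_Suc: "(case_nat a z)(Suc i := v) = case_nat a (z(i := v))"
  by (auto simp: fun_eq_iff split: nat.split)

lemma comp_case_nat: "f \<circ> case_nat a z = case_nat (f a) (f \<circ> z)"
  by (auto simp: fun_eq_iff split: nat.split)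

lemma case_nat_comp_Suc: "case_nat a z \<circ> Suc = z"
  by (auto simp: fun_eq_iff)

lemma seq_eq_case_nat: "x = case_nat (x 0) (x \<circ> Suc)"
  by (auto simp: fun_eq_iff split: nat.split)

section \<open>Shuffles\<close>

text \<open>An increasing map enumerates its image in order, and a finite set has only one
  increasing enumeration.\<close>

lemma strict_mono_on_image_unique:
  fixes f g :: "nat \<Rightarrow> nat"
  assumes "strict_mono_on {a..b} f" "strict_mono_on {a..b} g" "f ` {a..b} = g ` {a..b}"
    and "x \<in> {a..b}"
  shows "f x = g x"
proof -
  have "sorted_wrt (<) (map h [a..<Suc b])" if "strict_mono_on {a..b} h" for h :: "nat \<Rightarrow> nat"
    unfolding sorted_wrt_map
    by (rule sorted_wrt_mono_rel[OF _ sorted_wrt_upt]) (use that in \<open>auto simp: strict_mono_on_def\<close>)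
  moreover have "set (map f [a..<Suc b]) = set (map g [a..<Suc b])"
    using assms(3) by (simp add: atLeastLessThanSuc_atLeastAtMost del: upt_Suc)
  ultimately have "map f [a..<Suc b] = map g [a..<Suc b]"
    using assms(1,2) strict_sorted_equal by blast
  then show ?thesis
    using assms(4) by (auto simp: map_eq_conv simp del: upt_Suc)
qed

text \<open>The image of the second block is the complement of the image of the first, and on each
  block the image determines an increasing map.\<close>

lemma shuffle_perms_eqI:
  assumes "\<sigma> \<in> shuffle_perms i n" "\<tau> \<in> shuffle_perms i n" "i \<le> n"
    and img: "\<sigma> ` {1..i} = \<tau> ` {1..i}"
  shows "\<sigma> = \<tau>"
proof
  fix x
  have perm: "\<sigma> permutes {1..n}" "\<tau> permutes {1..n}"
    and mono: "strict_mono_on {1..i} \<sigma>" "strict_mono_on {1..i} \<tau>"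
      "strict_mono_on {i+1..n} \<sigma>" "strict_mono_on {i+1..n} \<tau>"
    using assms(1,2) by (auto simp: shuffle_perms_def)
  have "{i+1..n} = {1..n} - {1..i}" "{1..i} \<subseteq> {1..n}"
    using \<open>i \<le> n\<close> by auto
  then have "\<rho> ` {i+1..n} = {1..n} - \<rho> ` {1..i}" if "\<rho> permutes {1..n}" for \<rho>
    using that by (simp add: image_set_diff permutes_inj permutes_image)
  then have "\<sigma> ` {i+1..n} = \<tau> ` {i+1..n}"
    using perm img by simp
  moreover have "x \<in> {1..i} \<or> x \<in> {i+1..n} \<or> x \<notin> {1..n}"
    by auto
  ultimately show "\<sigma> x = \<tau> x"
    using strict_mono_on_image_unique[OF mono(1,2) img, of x]
      strict_mono_on_image_unique[OF mono(3,4), of x]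
      permutes_not_in[OF perm(1), of x] permutes_not_in[OF perm(2), of x] by argo
qed

text \<open>These cycles turn out to be the shuffles with a block of length one:
  \<open>cyc i k\<close> moves \<open>i\<close> behind the other elements of \<open>{1..k}\<close>,
  and \<open>cyc_inv 1 i\<close> moves \<open>i\<close> in front of all others.\<close>

definition cyc :: "nat \<Rightarrow> nat \<Rightarrow> nat \<Rightarrow> nat" where
  "cyc i k j = (if i \<le> j \<and> j < k then j + 1 else if j = k then i else j)"

definition cyc_inv :: "nat \<Rightarrow> nat \<Rightarrow> nat \<Rightarrow> nat" where
  "cyc_inv i k j = (if i < j \<and> j \<le> k then j - 1 else if j = i then k else j)"

text \<open>Lengthening the cycle by one is composition with an adjacent transposition, which
  contributes one factor -1.\<close>

lemma cyc_permutes_sign: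
  assumes "i \<le> k"
  shows "cyc i k permutes {i..k} \<and> sign (cyc i k) = (- 1) ^ (k - i)"
  using assms
proof (induction rule: dec_induct)
  case base
  have "cyc i i = id"
    by (auto simp: cyc_def fun_eq_iff)
  then show ?case by (simp only: permutes_id sign_id diff_self_eq_0 power_0)
next
  case (step k)
  have eq: "cyc i (Suc k) = cyc i k \<circ> transpose k (Suc k)"
    using step.hyps by (auto simp: cyc_def fun_eq_iff transpose_def)
  have perm: "cyc i k permutes {i..Suc k}"
    using step.IH by (auto intro: permutes_subset)
  have "transpose k (Suc k) permutes {i..Suc k}"
    using step.hyps by (intro permutes_swap_id) auto
  moreover have "sign (cyc i k \<circ> transpose k (Suc k)) = sign (cyc i k) * sign (transpose k (Suc k))"
    using perm by (intro sign_compose permutation_permutes[THEN iffD2] permutation_swap_id)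
      (auto intro!: exI[of _ "{i..Suc k}"])
  ultimately show ?case
    unfolding eq using perm step
    by (simp add: permutes_compose sign_swap_id Suc_diff_le del: o_apply)
qed

lemma cyc_inv_permutes_sign:
  assumes "i \<le> k"
  shows "cyc_inv i k permutes {i..k} \<and> sign (cyc_inv i k) = (- 1) ^ (k - i)"
proof -
  have "cyc i k permutes {i..k}" "sign (cyc i k) = (- 1) ^ (k - i)"
    using cyc_permutes_sign[OF assms] by auto
  moreover have "inv (cyc i k) = cyc_inv i k"
    by (rule inv_unique_comp) (use assms in \<open>auto simp: cyc_def cyc_inv_def fun_eq_iff\<close>)
  ultimately show ?thesis
    by (metis finite_atLeastAtMost permutation_permutes permutes_inv sign_inverse)
qed

lemma shuffle_perms_0: "shuffle_perms 0 n = {id}"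
proof -
  have "id \<in> shuffle_perms 0 n"
    by (auto simp: shuffle_perms_def permutes_id strict_mono_on_def)
  then show ?thesis
    using shuffle_perms_eqI[of _ 0 n id] by auto
qed

text \<open>A shuffle whose second block is the single place \<open>k\<close> is determined by its
  value there. This is the case of a product inserted into a cochain.\<close>

lemma shuffle_perms_last:
  assumes "k \<ge> 1"
  shows "shuffle_perms (k - 1) k = (\<lambda>i. cyc i k) ` {1..k}"
proof -
  have mem: "cyc i k \<in> shuffle_perms (k - 1) k" if "i \<in> {1..k}" for i
  proof -
    have "cyc i k permutes {1..k}"
      using that cyc_permutes_sign[of i k] by (auto intro: permutes_subset[of _ "{i..k}"])
    moreover have "strict_mono_on {1..k - 1} (cyc i k)" "strict_mono_on {k - 1 + 1..k} (cyc i k)"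
      using assms by (auto simp: strict_mono_on_def cyc_def)
    ultimately show ?thesis by (simp add: shuffle_perms_def)
  qed
  have img: "\<sigma> ` {1..k-1} = {1..k} - {\<sigma> k}" if "\<sigma> permutes {1..k}" for \<sigma>
  proof -
    have "{1..k-1} = {1..k} - {k}" using assms by auto
    then show ?thesis
      using that assms by (simp add: image_set_diff permutes_inj permutes_image)
  qed
  have "\<sigma> = cyc (\<sigma> k) k \<and> \<sigma> k \<in> {1..k}" if \<sigma>: "\<sigma> \<in> shuffle_perms (k - 1) k" for \<sigma>
  proof -
    have perm: "\<sigma> permutes {1..k}" using \<sigma> by (simp add: shuffle_perms_def)
    then have \<sigma>k: "\<sigma> k \<in> {1..k}" using assms permutes_in_image by fastforce
    from mem[OF this] have "cyc (\<sigma> k) k permutes {1..k}" by (simp add: shuffle_perms_def)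
    moreover have "cyc (\<sigma> k) k k = \<sigma> k"
      by (simp add: cyc_def)
    ultimately have "cyc (\<sigma> k) k ` {1..k-1} = \<sigma> ` {1..k-1}"
      by (metis img perm)
    then show ?thesis
      using shuffle_perms_eqI[OF \<sigma> mem[OF \<sigma>k]] \<sigma>k by simp
  qed
  then show ?thesis using mem by blast
qed

text \<open>Here the first block is a single place, and the value there determines the shuffle. This
  is the case of a cochain in the second slot of a product.\<close>

lemma shuffle_perms_first:
  assumes "n \<ge> 1"
  shows "shuffle_perms 1 n = (\<lambda>i. cyc_inv 1 i) ` {1..n}"
proof -
  have mem: "cyc_inv 1 i \<in> shuffle_perms 1 n" if "i \<in> {1..n}" for i
  proof -
    have "cyc_inv 1 i permutes {1..n}"
      using that cyc_inv_permutes_sign[of 1 i] by (auto intro: permutes_subset[of _ "{1..i}"])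
    moreover have "strict_mono_on {1..1} (cyc_inv 1 i)" "strict_mono_on {1 + 1..n} (cyc_inv 1 i)"
      by (auto simp: strict_mono_on_def cyc_inv_def)
    ultimately show ?thesis by (simp add: shuffle_perms_def)
  qed
  have "\<sigma> = cyc_inv 1 (\<sigma> 1) \<and> \<sigma> 1 \<in> {1..n}" if \<sigma>: "\<sigma> \<in> shuffle_perms 1 n" for \<sigma>
  proof -
    have \<sigma>1: "\<sigma> 1 \<in> {1..n}"
      using \<sigma> assms permutes_in_image by (fastforce simp: shuffle_perms_def)
    have "cyc_inv 1 (\<sigma> 1) ` {1..1} = \<sigma> ` {1..1}"
      by (simp add: cyc_inv_def)
    then show ?thesis
      using shuffle_perms_eqI[OF \<sigma> mem[OF \<sigma>1]] assms \<sigma>1 by simp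
  qed
  then show ?thesis using mem by blast
qed

text \<open>The deletion of one argument, usually written with a hat over it in coboundary
  formulas.\<close>

definition omit :: "nat \<Rightarrow> (nat \<Rightarrow> 'a) \<Rightarrow> nat \<Rightarrow> 'a" where
  "omit i x j = (if j < i then x j else x (Suc j))"

lemma multilinear_maps_cong:
  "f \<in> multilinear_maps scale n \<Longrightarrow> (\<And>i. i \<in> {1..n} \<Longrightarrow> x i = y i) \<Longrightarrow> f x = f y"
  unfolding multilinear_maps_def by blast

lemma omit_case_nat: "case_nat a (omit i x) = omit (Suc i) (case_nat a x)"
  by (auto simp: omit_def fun_eq_iff split: nat.split)

section \<open>Cartan calculus\<close>

context hom_leibniz
begin

section \<open>Linearity of the product and of the twist\<close>

lemma alpha_add: "\<alpha> (x + y) = \<alpha> x + \<alpha> y"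
  and alpha_scale: "\<alpha> (scale c x) = scale c (\<alpha> x)"
  and br_add_left: "br (x + y) z = br x z + br y z"
  and br_scale_left: "br (scale c x) z = scale c (br x z)"
  and br_add_right: "br x (y + z) = br x y + br x z"
  and br_scale_right: "br x (scale c z) = scale c (br x z)"
  using linear_alpha linear_br_left[of z] linear_br_right[of x]
  by (auto simp: Vector_Spaces.linear_iff)

lemma br_zero_right [simp]: "br x 0 = 0"
  using br_add_right[of x 0 0] by simp

lemma br_minus_right: "br x (- y) = - br x y"
  using br_add_right[of x y "- y"] by (simp add: eq_neg_iff_add_eq_0 add.commute)

lemma br_diff_left: "br (x - y) z = br x z - br y z"
  using br_add_left[of "x - y" y z] by (simp add: algebra_simps)

lemma br_diff_right: "br x (y - z) = br x y - br x z"
  using br_add_right[of x "y - z" z] by (simp add: algebra_simps)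

lemma alpha_pow_br: "(\<alpha> ^^ n) (br x y) = br ((\<alpha> ^^ n) x) ((\<alpha> ^^ n) y)"
  by (induction n) (simp_all add: multiplicative)

text \<open>The part of multilinearity on which the Cartan calculus rests, with slots numbered from
  0 so that an induction can split off slot 0.\<close>

definition multiadditive :: "nat \<Rightarrow> ((nat \<Rightarrow> 'v) \<Rightarrow> 'v) \<Rightarrow> bool" where
  "multiadditive m G \<longleftrightarrow>
     (\<forall>x y. (\<forall>i<m. x i = y i) \<longrightarrow> G x = G y) \<and>
     (\<forall>x u v. \<forall>i<m. G (x(i := u + v)) = G (x(i := u)) + G (x(i := v)))"

lemma multiadditive_0: "multiadditive 0 G \<Longrightarrow> G x = G y"
  by (auto simp: multiadditive_def)

lemma multiadditive_head:
  assumes "multiadditive (Suc m) G"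
  shows "G (case_nat (u + v) z) = G (case_nat u z) + G (case_nat v z)"
proof -
  have "G ((case_nat 0 z)(0 := u + v)) = G ((case_nat 0 z)(0 := u)) + G ((case_nat 0 z)(0 := v))"
    using assms unfolding multiadditive_def by blast
  then show ?thesis by (simp add: case_nat_upd_0)
qed

lemma multiadditive_tail:
  assumes "multiadditive (Suc m) G"
  shows "multiadditive m (\<lambda>z. G (case_nat a z))"
  unfolding multiadditive_def
proof (intro conjI allI impI)
  fix x y :: "nat \<Rightarrow> 'v"
  assume "\<forall>i<m. x i = y i"
  then have "\<forall>i<Suc m. case_nat a x i = case_nat a y i"
    by (auto split: nat.split)
  then show "G (case_nat a x) = G (case_nat a y)"
    using assms unfolding multiadditive_def by blast
next
  fix x u v i
  assume "i < m"
  then have "G ((case_nat a x)(Suc i := u + v)) =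
      G ((case_nat a x)(Suc i := u)) + G ((case_nat a x)(Suc i := v))"
    using assms unfolding multiadditive_def by auto
  then show "G (case_nat a (x(i := u + v))) = G (case_nat a (x(i := u))) + G (case_nat a (x(i := v)))"
    by (simp add: case_nat_upd_Suc)
qed

text \<open>
  Inserting a fixed vector into the first slot of a cochain destroys its compatibility with
  \<open>\<alpha>\<close>. The recursion on the arity is therefore carried out for families \<open>F\<close> with
  \<open>\<alpha> (F r x) = F (r + 1) (\<alpha> \<circ> x)\<close>: inserting \<open>(\<alpha> ^^ r) y\<close> into \<open>F r\<close> gives such a family
  again. A cochain is a constant family. Arguments are numbered from \<open>0\<close> here.
\<close>

definition slot_sum :: "'v \<Rightarrow> nat \<Rightarrow> ((nat \<Rightarrow> 'v) \<Rightarrow> 'v) \<Rightarrow> (nat \<Rightarrow> 'v) \<Rightarrow> 'v" where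
  "slot_sum y m G x = (\<Sum>j<m. G ((\<alpha> \<circ> x)(j := br y (x j))))"

lemma slot_sum_0 [simp]: "slot_sum y 0 G x = 0"
  by (simp add: slot_sum_def)

lemma slot_sum_Suc:
  "slot_sum y (Suc m) G x =
     G (case_nat (br y (x 0)) (\<alpha> \<circ> (x \<circ> Suc))) +
     slot_sum y m (\<lambda>z. G (case_nat (\<alpha> (x 0)) z)) (x \<circ> Suc)"
proof -
  have "\<alpha> \<circ> x = case_nat (\<alpha> (x 0)) (\<alpha> \<circ> (x \<circ> Suc))"
    using seq_eq_case_nat[of "\<alpha> \<circ> x"] by (simp add: comp_assoc)
  then show ?thesis
    by (simp add: slot_sum_def sum.lessThan_Suc_shift case_nat_upd_0 case_nat_upd_Suc
        del: sum.lessThan_Suc)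
qed

lemma slot_sum_add: "slot_sum y m (\<lambda>z. G z + H z) x = slot_sum y m G x + slot_sum y m H x"
  by (simp add: slot_sum_def sum.distrib)

lemma slot_sum_diff: "slot_sum y m (\<lambda>z. G z - H z) x = slot_sum y m G x - slot_sum y m H x"
  by (simp add: slot_sum_def sum_subtractf)

lemma slot_sum_minus: "slot_sum y m (\<lambda>z. - G z) x = - slot_sum y m G x"
  by (simp add: slot_sum_def sum_negf)

lemma br_sum_right: "br y (sum h A) = (\<Sum>j\<in>A. br y (h j))"
  by (induction A rule: infinite_finite_induct) (simp_all add: br_add_right)

lemma slot_sum_br: "slot_sum y m (\<lambda>z. br a (G z)) x = br a (slot_sum y m G x)"
  by (simp add: slot_sum_def br_sum_right)

lemma slot_sum_scale: "slot_sum y m (\<lambda>z. scale c (G z)) x = scale c (slot_sum y m G x)"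
  by (simp add: slot_sum_def scale_sum_right)

text \<open>Multiplicativity gives
  \<open>br (\<alpha> y) (\<alpha> (x j)) = \<alpha> (br y (x j))\<close>, so the twist can be moved
  out of each summand.\<close>

lemma slot_sum_alpha: "slot_sum (\<alpha> y) m G (\<alpha> \<circ> x) = slot_sum y m (\<lambda>z. G (\<alpha> \<circ> z)) x"
proof -
  have "(\<alpha> \<circ> (\<alpha> \<circ> x))(j := br (\<alpha> y) (\<alpha> (x j))) = \<alpha> \<circ> (\<alpha> \<circ> x)(j := br y (x j))" for j
    by (auto simp: fun_eq_iff multiplicative)
  then show ?thesis by (simp add: slot_sum_def)
qed

text \<open>The relation \<open>[L\<^sub>x, L\<^sub>y] = L\<close> of \<open>br x y\<close>, for the
  action on the arguments alone. Terms in which \<open>x\<close> and \<open>y\<close> hit different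
  slots are symmetric in \<open>x\<close> and \<open>y\<close>; where both hit the same slot, the
  Hom-Leibniz identity applies.\<close>

lemma slot_sum_commute:
  assumes "multiadditive m G"
  shows "slot_sum x m (slot_sum (\<alpha> y) m G) z + slot_sum (br x y) m G (\<alpha> \<circ> z) =
         slot_sum y m (slot_sum (\<alpha> x) m G) z"
  using assms
proof (induction m arbitrary: G z)
  case 0
  then show ?case by simp
next
  case (Suc m)
  let ?t = "z \<circ> Suc" and ?a = "z 0"
  \<comment> \<open>Stated for arbitrary \<open>x\<close> and \<open>y\<close> to serve both orders:
    exchanging them merely swaps the two middle summands.\<close>
  have expand: "slot_sum x (Suc m) (slot_sum (\<alpha> y) (Suc m) G) z =
      G (case_nat (br (\<alpha> y) (br x ?a)) (\<alpha> \<circ> (\<alpha> \<circ> ?t))) +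
      slot_sum y m (\<lambda>w. G (case_nat (\<alpha> (br x ?a)) (\<alpha> \<circ> w))) ?t +
      slot_sum x m (\<lambda>w. G (case_nat (\<alpha> (br y ?a)) (\<alpha> \<circ> w))) ?t +
      slot_sum x m (slot_sum (\<alpha> y) m (\<lambda>w. G (case_nat (\<alpha> (\<alpha> ?a)) w))) ?t" for x y
    by (simp add: slot_sum_Suc case_nat_comp_Suc slot_sum_add slot_sum_alpha multiplicative
        comp_assoc)
  have "G (case_nat (br (\<alpha> x) (br y ?a)) w) =
      G (case_nat (br (br x y) (\<alpha> ?a)) w) + G (case_nat (br (\<alpha> y) (br x ?a)) w)" for w
    unfolding hom_leibniz_identity[of x y] multiadditive_head[OF Suc.prems] ..
  moreover have "slot_sum (br x y) (Suc m) G (\<alpha> \<circ> z) =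
      G (case_nat (br (br x y) (\<alpha> ?a)) (\<alpha> \<circ> (\<alpha> \<circ> ?t))) +
      slot_sum (br x y) m (\<lambda>w. G (case_nat (\<alpha> (\<alpha> ?a)) w)) (\<alpha> \<circ> ?t)"
    by (simp add: slot_sum_Suc comp_assoc)
  ultimately show ?case
    unfolding expand Suc.IH[OF multiadditive_tail[OF Suc.prems], symmetric]
    by (simp add: algebra_simps del: o_apply)
qed

text \<open>The action \<open>L\<^sub>y\<close> on an \<open>m\<close>-cochain: on the value, minus
  on the arguments. The slot sum twists all other arguments by \<alpha>, including vectors inserted
  earlier, hence \<open>F 1\<close> there.\<close>

definition lie :: "nat \<Rightarrow> nat \<Rightarrow> 'v \<Rightarrow> (nat \<Rightarrow> (nat \<Rightarrow> 'v) \<Rightarrow> 'v) \<Rightarrow> (nat \<Rightarrow> 'v) \<Rightarrow> 'v" where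
  "lie s m y F x = br ((\<alpha> ^^ s) y) (F 0 x) - slot_sum y m (F 1) x"

text \<open>Makes \<open>r\<close> the starting index, because \<open>lie\<close> and
  \<open>coboundary\<close> read a family at the indices 0 and 1.\<close>

definition shift :: "nat \<Rightarrow> (nat \<Rightarrow> 'b) \<Rightarrow> nat \<Rightarrow> 'b" where
  "shift r F r' = F (r + r')"

definition lie_fam :: "nat \<Rightarrow> nat \<Rightarrow> 'v \<Rightarrow> (nat \<Rightarrow> (nat \<Rightarrow> 'v) \<Rightarrow> 'v) \<Rightarrow> nat \<Rightarrow> (nat \<Rightarrow> 'v) \<Rightarrow> 'v"
  where "lie_fam s m y F r = lie s m ((\<alpha> ^^ r) y) (shift r F)"

definition insert_fam :: "'v \<Rightarrow> (nat \<Rightarrow> (nat \<Rightarrow> 'v) \<Rightarrow> 'v) \<Rightarrow> nat \<Rightarrow> (nat \<Rightarrow> 'v) \<Rightarrow> 'v" where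
  "insert_fam y F r z = F r (case_nat ((\<alpha> ^^ r) y) z)"

text \<open>
  Cartan's formula \<open>\<iota>\<^sub>y \<delta> = - L\<^sub>y - \<delta> \<iota>\<^sub>y\<close> serves as the definition of the coboundary of an
  \<open>m\<close>-cochain. For an actual cochain \<open>s = m - 1\<close>; as \<open>\<iota>\<^sub>y\<close> lowers the arity but not the
  power of \<open>\<alpha>\<close>, the recursion needs \<open>s\<close> and \<open>m\<close> to be independent.
\<close>

fun coboundary :: "nat \<Rightarrow> nat \<Rightarrow> (nat \<Rightarrow> (nat \<Rightarrow> 'v) \<Rightarrow> 'v) \<Rightarrow> (nat \<Rightarrow> 'v) \<Rightarrow> 'v" where
  "coboundary s 0 F x = br (F 0 x) ((\<alpha> ^^ s) (x 0))"
| "coboundary s (Suc m) F x =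
     - lie s (Suc m) (x 0) F (x \<circ> Suc) - coboundary s m (insert_fam (x 0) F) (x \<circ> Suc)"

definition coboundary_fam :: "nat \<Rightarrow> nat \<Rightarrow> (nat \<Rightarrow> (nat \<Rightarrow> 'v) \<Rightarrow> 'v) \<Rightarrow> nat \<Rightarrow> (nat \<Rightarrow> 'v) \<Rightarrow> 'v" where
  "coboundary_fam s m F r = coboundary s m (shift r F)"

lemma shift_0 [simp]: "shift 0 F = F"
  by (simp add: shift_def[abs_def])

lemma lie_fam_0: "lie_fam s m y F 0 = lie s m y F"
  and coboundary_fam_0: "coboundary_fam s m F 0 = coboundary s m F"
  by (simp_all add: lie_fam_def coboundary_fam_def)

lemma lie_diff: "lie s m y (\<lambda>r z. F r z - H r z) x = lie s m y F x - lie s m y H x"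
  by (simp add: lie_def slot_sum_diff br_diff_right)

lemma coboundary_diff: "coboundary s m (\<lambda>r z. F r z - H r z) x = coboundary s m F x - coboundary s m H x"
proof (induction m arbitrary: F H x)
  case 0
  then show ?case by (simp add: br_diff_left)
next
  case (Suc m)
  have "insert_fam a (\<lambda>r z. F r z - H r z) = (\<lambda>r z. insert_fam a F r z - insert_fam a H r z)" for a
    by (simp add: insert_fam_def fun_eq_iff)
  then show ?case by (simp add: lie_diff Suc.IH del: o_apply)
qed

lemma coboundary_scale: "coboundary s m (\<lambda>r z. scale c (F r z)) x = scale c (coboundary s m F x)"
proof (induction m arbitrary: F x)
  case 0
  then show ?case by (simp add: br_scale_left)
next
  case (Suc m)
  have "insert_fam a (\<lambda>r z. scale c (F r z)) = (\<lambda>r z. scale c (insert_fam a F r z))" for a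
    by (simp add: insert_fam_def fun_eq_iff)
  then show ?case
    by (simp add: lie_def slot_sum_scale br_scale_right Suc.IH scale_right_diff_distrib del: o_apply)
qed

lemma coboundary_minus: "coboundary s m (\<lambda>r z. - F r z) x = - coboundary s m F x"
  using coboundary_scale[of s m "-1" F x] by simp

lemma shift_insert_fam: "shift r (insert_fam y F) = insert_fam ((\<alpha> ^^ r) y) (shift r F)"
proof -
  have "(\<alpha> ^^ (r + r')) y = (\<alpha> ^^ r') ((\<alpha> ^^ r) y)" for r'
    by (metis add.commute comp_apply funpow_add)
  then show ?thesis by (simp add: shift_def insert_fam_def fun_eq_iff)
qed

text \<open>Cartan's formula for whole families, as is needed when a coboundary is itself fed to
  \<open>lie\<close> or \<open>coboundary\<close>.\<close>

lemma insert_coboundary_fam: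
  "insert_fam y (coboundary_fam s (Suc m) F) =
     (\<lambda>r z. - lie_fam s (Suc m) y F r z - coboundary_fam s m (insert_fam y F) r z)"
  by (simp add: insert_fam_def[of _ "coboundary_fam _ _ _"] coboundary_fam_def lie_fam_def case_nat_comp_Suc
      shift_insert_fam fun_eq_iff)

text \<open>The commutator of \<open>\<iota>\<^sub>y\<close> and \<open>L\<^sub>x\<close> is
  insertion of \<open>br x y\<close>: the subtracted term is the slot 0 summand of the action, whose
  remaining arguments are twisted.\<close>

lemma insert_lie_fam:
  "insert_fam y (lie_fam s (Suc m) x F) =
     (\<lambda>r z. lie_fam s m x (insert_fam y F) r z - insert_fam (br x y) (shift 1 F) r (\<alpha> \<circ> z))"
  by (simp add: insert_fam_def[abs_def] lie_fam_def lie_def slot_sum_Suc case_nat_comp_Suc shift_def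
      alpha_pow_br fun_eq_iff)

lemma lie_alpha: "lie (Suc s) m y (\<lambda>r z. F r (\<alpha> \<circ> z)) x = lie s m (\<alpha> y) F (\<alpha> \<circ> x)"
  by (simp add: lie_def slot_sum_alpha funpow_swap1)

text \<open>A twist of all arguments trades against one power of \<alpha> in \<open>s\<close>. This
  absorbs the \<open>\<alpha> \<circ> z\<close> produced by \<open>insert_lie_fam\<close>.\<close>

lemma coboundary_alpha: "coboundary (Suc s) m (\<lambda>r z. F r (\<alpha> \<circ> z)) x = coboundary s m F (\<alpha> \<circ> x)"
proof (induction m arbitrary: F x)
  case 0
  then show ?case by (simp add: funpow_swap1)
next
  case (Suc m)
  have "insert_fam a (\<lambda>r z. F r (\<alpha> \<circ> z)) = (\<lambda>r z. insert_fam (\<alpha> a) F r (\<alpha> \<circ> z))" for a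
    by (simp add: insert_fam_def fun_eq_iff comp_case_nat funpow_swap1)
  then show ?case by (simp add: lie_alpha Suc.IH comp_assoc o_apply[of \<alpha> x 0] del: o_apply)
qed

definition cochain_fam :: "nat \<Rightarrow> (nat \<Rightarrow> (nat \<Rightarrow> 'v) \<Rightarrow> 'v) \<Rightarrow> bool" where
  "cochain_fam m F \<longleftrightarrow>
     (\<forall>r. multiadditive m (F r)) \<and> (\<forall>r x. \<alpha> (F r x) = F (Suc r) (\<alpha> \<circ> x))"

lemma cochain_fam_insert: "cochain_fam (Suc m) F \<Longrightarrow> cochain_fam m (insert_fam y F)"
  by (simp add: cochain_fam_def insert_fam_def[abs_def] multiadditive_tail comp_case_nat)

text \<open>Terms acting once on the value and once on an argument are symmetric in \<open>x\<close>
  and \<open>y\<close>. The Hom-Leibniz identity handles the two actions on the value,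
  \<open>slot_sum_commute\<close> those on the arguments.\<close>

lemma lie_commute:
  assumes "cochain_fam m F"
  shows "lie (Suc s) m x (lie_fam s m y F) z =
    lie (Suc s) m y (lie_fam s m x F) z + lie s m (br x y) (shift 1 F) (\<alpha> \<circ> z)"
proof -
  have expand: "lie (Suc s) m x (lie_fam s m y F) z =
     br (\<alpha> ((\<alpha> ^^ s) x)) (br ((\<alpha> ^^ s) y) (F 0 z)) - br ((\<alpha> ^^ Suc s) x) (slot_sum y m (F 1) z) -
     br ((\<alpha> ^^ Suc s) y) (slot_sum x m (F 1) z) + slot_sum x m (slot_sum (\<alpha> y) m (F 2)) z" for x y
    by (simp add: lie_def[abs_def] lie_fam_def shift_def slot_sum_diff slot_sum_br br_diff_right
        funpow_swap1 numeral_2_eq_2)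
  \<comment> \<open>Equivariance replaces \<open>F 1 (\<alpha> \<circ> z)\<close> by
    \<open>\<alpha> (F 0 z)\<close>, the shape found in the Hom-Leibniz identity.\<close>
  have "lie s m (br x y) (shift 1 F) (\<alpha> \<circ> z) =
      br (br ((\<alpha> ^^ s) x) ((\<alpha> ^^ s) y)) (\<alpha> (F 0 z)) - slot_sum (br x y) m (F 2) (\<alpha> \<circ> z)"
    using assms by (simp add: lie_def shift_def alpha_pow_br cochain_fam_def numeral_2_eq_2)
  moreover have "slot_sum y m (slot_sum (\<alpha> x) m (F 2)) z =
      slot_sum x m (slot_sum (\<alpha> y) m (F 2)) z + slot_sum (br x y) m (F 2) (\<alpha> \<circ> z)"
    using assms slot_sum_commute by (simp add: cochain_fam_def)
  ultimately show ?thesis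
    unfolding expand hom_leibniz_identity[of "(\<alpha> ^^ s) x" "(\<alpha> ^^ s) y"]
    by (simp add: algebra_simps)
qed

text \<open>\<open>L\<^sub>x \<delta> = \<delta> L\<^sub>x\<close>. Cartan's formula with
  \<open>y = z 0\<close> reduces this to the commutation of \<open>L\<^sub>x\<close> with
  \<open>L\<^sub>y\<close>, with \<open>\<iota>\<^sub>y\<close> and, by induction, with \<delta> in
  lower arity.\<close>

lemma lie_coboundary:
  assumes "cochain_fam m F"
  shows "lie (Suc s) (Suc m) x (coboundary_fam s m F) z = coboundary (Suc s) m (lie_fam s m x F) z"
  using assms
proof (induction m arbitrary: F z)
  case 0
  let ?X = "(\<alpha> ^^ s) x" and ?Y = "(\<alpha> ^^ s) (z 0)"
  \<comment> \<open>In arity 0 each member of the family is constant, and equivariance links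
    consecutive members.\<close>
  have "F 1 w = \<alpha> (F 0 z)" for w
    using 0 multiadditive_0[of "F 1"] by (metis One_nat_def cochain_fam_def)
  then have "lie (Suc s) (Suc 0) x (coboundary_fam s 0 F) z =
      br (\<alpha> ?X) (br (F 0 z) ?Y) - br (\<alpha> (F 0 z)) (br ?X ?Y)"
    by (simp add: lie_def coboundary_fam_def shift_def slot_sum_def alpha_pow_br)
  then show ?case
    using hom_leibniz_identity[of ?X "F 0 z" ?Y] by (simp add: lie_fam_def lie_def shift_def)
next
  case (Suc m)
  let ?y = "z 0" and ?t = "z \<circ> Suc"
  \<comment> \<open>Slot 0 turns \<open>?y\<close> into \<open>br x ?y\<close>, the other slots turn
    it into \<open>\<alpha> ?y\<close>; in both cases the recursion for the coboundary is then
    unrolled once.\<close>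
  have slot: "slot_sum x (Suc (Suc m)) (coboundary s (Suc m) (shift 1 F)) z =
      - lie s (Suc m) (br x ?y) (shift 1 F) (\<alpha> \<circ> ?t)
      - coboundary s m (insert_fam (br x ?y) (shift 1 F)) (\<alpha> \<circ> ?t)
      + slot_sum x (Suc m)
          (\<lambda>w. - lie_fam s (Suc m) ?y F 1 w - coboundary_fam s m (insert_fam ?y F) 1 w) ?t"
    unfolding slot_sum_Suc[of x "Suc m"] coboundary.simps case_nat_comp_Suc nat.case
    by (simp add: lie_fam_def coboundary_fam_def shift_insert_fam del: o_apply)
  have "lie (Suc s) (Suc (Suc m)) x (coboundary_fam s (Suc m) F) z =
      br ((\<alpha> ^^ Suc s) x) (coboundary s (Suc m) F z) - slot_sum x (Suc (Suc m)) (coboundary s (Suc m) (shift 1 F)) z"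
    by (simp only: lie_def coboundary_fam_def shift_0)
  also have "\<dots> =
      br ((\<alpha> ^^ Suc s) x) (- lie s (Suc m) ?y F ?t - coboundary s m (insert_fam ?y F) ?t)
      - (- lie s (Suc m) (br x ?y) (shift 1 F) (\<alpha> \<circ> ?t)
         - coboundary s m (insert_fam (br x ?y) (shift 1 F)) (\<alpha> \<circ> ?t)
         + slot_sum x (Suc m)
             (\<lambda>w. - lie_fam s (Suc m) ?y F 1 w - coboundary_fam s m (insert_fam ?y F) 1 w) ?t)"
    by (simp only: slot, simp only: coboundary.simps)
  also have "\<dots> = - lie (Suc s) (Suc m) x (lie_fam s (Suc m) ?y F) ?t
      - lie (Suc s) (Suc m) x (coboundary_fam s m (insert_fam ?y F)) ?t
      + lie s (Suc m) (br x ?y) (shift 1 F) (\<alpha> \<circ> ?t)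
      + coboundary s m (insert_fam (br x ?y) (shift 1 F)) (\<alpha> \<circ> ?t)"
    unfolding lie_def[of "Suc s"] slot_sum_diff slot_sum_minus br_diff_right br_minus_right
      lie_fam_0 coboundary_fam_0 by simp
  \<comment> \<open>Exchanging \<open>L\<^sub>x\<close> and \<open>L\<^sub>y\<close> yields a term
    for \<open>br x ?y\<close> that cancels the one from slot 0; the induction hypothesis moves
    \<open>L\<^sub>x\<close> inside the other coboundary.\<close>
  also have "\<dots> = - lie (Suc s) (Suc m) ?y (lie_fam s (Suc m) x F) ?t
      - coboundary (Suc s) m (lie_fam s m x (insert_fam ?y F)) ?t
      + coboundary s m (insert_fam (br x ?y) (shift 1 F)) (\<alpha> \<circ> ?t)"
    unfolding lie_commute[OF Suc.prems, of s x ?y] Suc.IH[OF cochain_fam_insert[OF Suc.prems]]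
    by simp
  \<comment> \<open>The last two terms combine to the coboundary of
    \<open>\<iota>\<^sub>y L\<^sub>x F\<close>.\<close>
  also have "\<dots> = coboundary (Suc s) (Suc m) (lie_fam s (Suc m) x F) z"
    unfolding coboundary.simps insert_lie_fam coboundary_diff coboundary_alpha by simp
  finally show ?case .
qed

text \<open>Applying Cartan's formula twice gives \<open>\<iota>\<^sub>y \<delta> \<delta> = -
  L\<^sub>y \<delta> + \<delta> L\<^sub>y + \<delta> \<delta> \<iota>\<^sub>y\<close>; the first two
  terms cancel and the third vanishes by induction.\<close>

lemma coboundary_coboundary:
  assumes "cochain_fam m F"
  shows "coboundary (Suc s) (Suc m) (coboundary_fam s m F) x = 0"
  using assms
proof (induction m arbitrary: F x)
  case 0
  let ?X = "(\<alpha> ^^ s) (x 0)" and ?Y = "(\<alpha> ^^ s) (x 1)"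
  have F0: "F 0 w = F 0 x" and F1: "F 1 w = \<alpha> (F 0 x)" for w
    using 0 multiadditive_0[of "F 0"] multiadditive_0[of "F 1"]
    by (metis cochain_fam_def, metis One_nat_def cochain_fam_def)
  have "coboundary (Suc s) (Suc 0) (coboundary_fam s 0 F) x =
      br (\<alpha> (F 0 x)) (br ?X ?Y) - br (\<alpha> ?X) (br (F 0 x) ?Y) - br (br (F 0 x) ?X) (\<alpha> ?Y)"
    using F1 by (simp add: lie_def coboundary_fam_def shift_def slot_sum_def alpha_pow_br insert_fam_def
        F0[of "x \<circ> Suc"] F0[of "case_nat a b" for a b])
  then show ?case
    using hom_leibniz_identity[of "F 0 x" ?X ?Y] by simp
next
  case (Suc m)
  have "coboundary (Suc s) (Suc (Suc m)) (coboundary_fam s (Suc m) F) x =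
      - lie (Suc s) (Suc (Suc m)) (x 0) (coboundary_fam s (Suc m) F) (x \<circ> Suc)
      - coboundary (Suc s) (Suc m) (insert_fam (x 0) (coboundary_fam s (Suc m) F)) (x \<circ> Suc)"
    by (rule coboundary.simps)
  also have "\<dots> = 0"
    unfolding insert_coboundary_fam coboundary_diff coboundary_minus lie_coboundary[OF Suc.prems]
      Suc.IH[OF cochain_fam_insert[OF Suc.prems]]
    by simp
  finally show ?case .
qed

section \<open>The bracket with a Hom-Leibniz product as a coboundary\<close>

lemma partial_comp_br_1:
  assumes "f \<in> multilinear_maps scale (q + 1)"
  shows "partial_comp scale \<alpha> q 1 (bracket_cochain br) f x = br (f x) ((\<alpha> ^^ q) (x (q + 2)))"
proof -
  have "f (\<lambda>j. if j \<le> q then x j else x (Suc q)) = f x"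
    by (rule multilinear_maps_cong[OF assms]) (auto simp: le_Suc_eq)
  then show ?thesis
    unfolding partial_comp_def diff_self_eq_0 add_0 shuffle_perms_0 bracket_cochain_def
    by (simp cong: if_cong)
qed

text \<open>The shuffle selects the argument \<open>i\<close> that goes in front of
  \<open>f\<close>. The last argument \<open>q + 2\<close> is never selected, so \<open>i\<close>
  stops at \<open>q + 1\<close>.\<close>

lemma partial_comp_br_2:
  assumes "f \<in> multilinear_maps scale (q + 1)"
  shows "partial_comp scale \<alpha> q 2 (bracket_cochain br) f x =
    (\<Sum>i = 1..q + 1. scale ((- 1) ^ (i - 1)) (br ((\<alpha> ^^ q) (x i)) (f (omit i x))))"
proof -
  have inj: "inj_on (\<lambda>i. cyc_inv 1 i) {1..q + 1}"
    by (rule inj_onI) (metis cyc_inv_def less_irrefl)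
  have args: "f (\<lambda>j. if j \<le> q then x (cyc_inv 1 i (2 - 1 + j)) else x (2 + q)) = f (omit i x)"
    if "i \<in> {1..q + 1}" for i
    by (rule multilinear_maps_cong[OF assms]) (use that in \<open>auto simp: omit_def cyc_inv_def le_Suc_eq\<close>)
  have shuffles: "shuffle_perms (2 - 1) (2 - 1 + q) = (\<lambda>i. cyc_inv 1 i) ` {1..q + 1}"
    using shuffle_perms_first[of "q + 1"] by simp
  have "partial_comp scale \<alpha> q 2 (bracket_cochain br) f x =
    (\<Sum>i = 1..q + 1. scale (of_int (sign (cyc_inv 1 i))) (br ((\<alpha> ^^ q) (x (cyc_inv 1 i 1)))
       (f (\<lambda>j. if j \<le> q then x (cyc_inv 1 i (2 - 1 + j)) else x (2 + q)))))"
    unfolding partial_comp_def shuffles sum.reindex[OF inj] bracket_cochain_def o_def by simp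
  also have "\<dots> = (\<Sum>i = 1..q + 1. scale ((- 1) ^ (i - 1)) (br ((\<alpha> ^^ q) (x i)) (f (omit i x))))"
    by (rule sum.cong[OF refl]) (use cyc_inv_permutes_sign[of 1] args in \<open>simp add: cyc_inv_def\<close>)
  finally show ?thesis .
qed

text \<open>The shuffle selects the \<open>x i\<close> to be bracketed with
  \<open>x (k + 1)\<close>; the remaining arguments close the gap and are twisted once.\<close>

lemma partial_comp_of_br:
  assumes "k \<ge> 1"
  shows "partial_comp scale \<alpha> 1 k f (bracket_cochain br) x =
    (\<Sum>i = 1..k. scale ((- 1) ^ (k - i)) (f (omit i ((\<alpha> \<circ> x)(k + 1 := br (x i) (x (k + 1)))))))"
proof -
  have inj: "inj_on (\<lambda>i. cyc i k) {1..k}"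
    by (rule inj_onI) (metis cyc_def less_irrefl)
  have args: "(\<lambda>j. if j < k then (\<alpha> ^^ 1) (x (cyc i k j))
          else if j = k then bracket_cochain br (\<lambda>j. if j \<le> 1 then x (cyc i k (k - 1 + j)) else x (k + 1))
          else (\<alpha> ^^ 1) (x (j + 1))) = omit i ((\<alpha> \<circ> x)(k + 1 := br (x i) (x (k + 1))))"
    if "i \<in> {1..k}" for i
    using that assms by (auto simp: fun_eq_iff omit_def cyc_def bracket_cochain_def)
  have "partial_comp scale \<alpha> 1 k f (bracket_cochain br) x =
    (\<Sum>i = 1..k. scale (of_int (sign (cyc i k)))
       (f (\<lambda>j. if j < k then (\<alpha> ^^ 1) (x (cyc i k j))
          else if j = k then bracket_cochain br (\<lambda>j. if j \<le> 1 then x (cyc i k (k - 1 + j)) else x (k + 1))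
          else (\<alpha> ^^ 1) (x (j + 1)))))"
    unfolding partial_comp_def using assms shuffle_perms_last[of k]
    by (simp only: le_add_diff_inverse2 sum.reindex[OF inj] o_def)
  also have "\<dots> = (\<Sum>i = 1..k. scale ((- 1) ^ (k - i))
      (f (omit i ((\<alpha> \<circ> x)(k + 1 := br (x i) (x (k + 1)))))))"
    by (rule sum.cong[OF refl]) (use cyc_permutes_sign[of _ k] args in simp)
  finally show ?thesis .
qed

text \<open>The sign \<open>(- 1) ^ (k - 1)\<close> of the insertion and
  \<open>(- 1) ^ (k - i)\<close> of the shuffle multiply to \<open>(- 1) ^ (i - 1)\<close>, free of
  \<open>k\<close>. Exchanging the sums and putting \<open>j = k + 1\<close> gives the
  formula.\<close>

lemma circ_of_br:
  "circ scale \<alpha> q 1 f (bracket_cochain br) x =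
     (\<Sum>i = 1..q + 1. scale ((- 1) ^ (i - 1))
        (\<Sum>j = i + 1..q + 2. f (omit i ((\<alpha> \<circ> x)(j := br (x i) (x j))))))"
proof -
  define H where "H i j = f (omit i ((\<alpha> \<circ> x)(j := br (x i) (x j))))" for i j
  have sgn: "(- 1 :: 'k) ^ (k - 1) * (- 1) ^ (k - i) = (- 1) ^ (i - 1)" if "1 \<le> i" "i \<le> k" for i k
  proof -
    have "(k - 1) + (k - i) = (i - 1) + 2 * (k - i)"
      using that by simp
    then have "(- 1 :: 'k) ^ (k - 1) * (- 1) ^ (k - i) = (- 1) ^ (i - 1) * ((- 1) ^ 2) ^ (k - i)"
      by (simp only: power_add[symmetric] power_mult[symmetric])
    then show ?thesis by simp
  qed
  have "circ scale \<alpha> q 1 f (bracket_cochain br) x =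
      (\<Sum>k = 1..q + 1. \<Sum>i | i \<in> {1..q + 1} \<and> i \<le> k. scale ((- 1) ^ (i - 1)) (H i (k + 1)))"
    unfolding circ_def mult_1_right
  proof (rule sum.cong[OF refl])
    fix k assume k: "k \<in> {1..q + 1}"
    then have eq: "{i \<in> {1..q + 1}. i \<le> k} = {1..k}" by auto
    have "scale ((- 1) ^ (k - 1)) (partial_comp scale \<alpha> 1 k f (bracket_cochain br) x) =
        (\<Sum>i = 1..k. scale ((- 1) ^ (k - 1) * (- 1) ^ (k - i)) (H i (k + 1)))"
      unfolding H_def scale_scale[symmetric] scale_sum_right[symmetric]
      by (subst partial_comp_of_br) (use k in auto)
    also have "\<dots> = (\<Sum>i = 1..k. scale ((- 1) ^ (i - 1)) (H i (k + 1)))"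
      by (rule sum.cong[OF refl]) (use sgn in auto)
    finally show "scale ((- 1) ^ (k - 1)) (partial_comp scale \<alpha> 1 k f (bracket_cochain br) x) =
        (\<Sum>i | i \<in> {1..q + 1} \<and> i \<le> k. scale ((- 1) ^ (i - 1)) (H i (k + 1)))"
      unfolding eq .
  qed
  also have "\<dots> = (\<Sum>i = 1..q + 1. \<Sum>k | k \<in> {1..q + 1} \<and> i \<le> k.
      scale ((- 1) ^ (i - 1)) (H i (k + 1)))"
    by (rule sum.swap_restrict) auto
  also have "\<dots> = (\<Sum>i = 1..q + 1. scale ((- 1) ^ (i - 1)) (\<Sum>j = i + 1..q + 2. H i j))"
  proof (rule sum.cong[OF refl])
    fix i assume "i \<in> {1..q + 1}"
    then have "{k \<in> {1..q + 1}. i \<le> k} = {i..q + 1}" by auto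
    then show "(\<Sum>k | k \<in> {1..q + 1} \<and> i \<le> k. scale ((- 1) ^ (i - 1)) (H i (k + 1))) =
        scale ((- 1) ^ (i - 1)) (\<Sum>j = i + 1..q + 2. H i j)"
      using sum.shift_bounds_cl_Suc_ivl[of "H i" i "q + 1"]
      by (simp add: scale_sum_right del: sum.cl_ivl_Suc)
  qed
  finally show ?thesis by (simp add: H_def)
qed

text \<open>The twisted Loday-Pirashvili formula. Unrolling the recursion splits off
  \<open>x 0\<close>, ..., \<open>x (m - 1)\<close> in turn, each with a further sign; the base
  clause supplies the term acting from the right.\<close>

lemma coboundary_eq:
  "coboundary s m F x =
     (\<Sum>i<m. scale ((- 1) ^ Suc i) (br ((\<alpha> ^^ s) (x i)) (F 0 (omit i x)) -
        (\<Sum>j = Suc i..m. F 1 (omit i ((\<alpha> \<circ> x)(j := br (x i) (x j))))))) +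
     scale ((- 1) ^ m) (br (F 0 x) ((\<alpha> ^^ s) (x m)))"
proof (induction m arbitrary: F x)
  case 0
  then show ?case by simp
next
  case (Suc m)
  let ?t = "x \<circ> Suc" and ?T = "\<lambda>i. br ((\<alpha> ^^ s) (x i)) (F 0 (omit i x)) -
        (\<Sum>j = Suc i..Suc m. F 1 (omit i ((\<alpha> \<circ> x)(j := br (x i) (x j)))))"
  have head: "?T 0 = lie s (Suc m) (x 0) F ?t"
  proof -
    have "omit 0 x = ?t" "omit 0 ((\<alpha> \<circ> x)(Suc j := v)) = (\<alpha> \<circ> ?t)(j := v)" for j v
      by (auto simp: omit_def fun_eq_iff)
    then show ?thesis
      by (simp add: lie_def slot_sum_def sum.atLeast1_atMost_eq del: sum.lessThan_Suc sum.cl_ivl_Suc)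
  qed
  \<comment> \<open>With \<open>x 0\<close> inserted, summand \<open>i\<close> of the formula for
    the tail is summand \<open>Suc i\<close> for \<open>x\<close>.\<close>
  have tail: "br ((\<alpha> ^^ s) (?t i)) (insert_fam (x 0) F 0 (omit i ?t)) -
        (\<Sum>j = Suc i..m. insert_fam (x 0) F 1 (omit i ((\<alpha> \<circ> ?t)(j := br (?t i) (?t j))))) =
      ?T (Suc i)" for i
  proof -
    have "case_nat (x 0) (omit i ?t) = omit (Suc i) x"
      by (simp add: omit_case_nat flip: seq_eq_case_nat)
    moreover have "case_nat (\<alpha> (x 0)) ((\<alpha> \<circ> ?t)(j := v)) = (\<alpha> \<circ> x)(Suc j := v)" for j v
      by (auto simp: fun_eq_iff split: nat.split)
    ultimately show ?thesis
      by (simp add: insert_fam_def omit_case_nat[of "\<alpha> (x 0)"] sum.shift_bounds_cl_Suc_ivl del: sum.cl_ivl_Suc)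
  qed
  have "coboundary s (Suc m) F x = - ?T 0 - (\<Sum>i<m. scale ((- 1) ^ Suc i) (?T (Suc i)))
      - scale ((- 1) ^ m) (br (F 0 x) ((\<alpha> ^^ s) (x (Suc m))))"
    unfolding coboundary.simps Suc.IH tail head
    by (simp add: insert_fam_def flip: seq_eq_case_nat)
  then show ?case
    by (simp add: sum.lessThan_Suc_shift sum_negf
        del: sum.lessThan_Suc sum.cl_ivl_Suc o_apply fun_upd_apply)
qed

text \<open>Converts from the numbering of arguments from \<open>1\<close> to that from \<open>0\<close>.\<close>

definition hat :: "((nat \<Rightarrow> 'v) \<Rightarrow> 'v) \<Rightarrow> (nat \<Rightarrow> 'v) \<Rightarrow> 'v" where
  "hat f z = f (\<lambda>i. z (i - 1))"

lemma hat_tail: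
  assumes "f \<in> multilinear_maps scale m"
  shows "hat f (x \<circ> Suc) = f x"
  unfolding hat_def by (rule multilinear_maps_cong[OF assms]) auto

text \<open>Term by term: \<open>f\<close> in the first slot of the product gives the right action,
  \<open>f\<close> in the second slot the left actions, and the product inserted into
  \<open>f\<close> the slot sums.\<close>

lemma balavoine_bracket_eq_coboundary:
  assumes f: "f \<in> multilinear_maps scale (q + 1)"
  shows "balavoine_bracket scale \<alpha> 1 q (bracket_cochain br) f x =
    scale ((- 1) ^ (q + 1)) (coboundary q (q + 1) (\<lambda>r. hat f) (x \<circ> Suc))"
proof -
  let ?T = "\<lambda>i. br ((\<alpha> ^^ q) (x i)) (f (omit i x)) -
        (\<Sum>j = i + 1..q + 2. f (omit i ((\<alpha> \<circ> x)(j := br (x i) (x j)))))"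
  have omit_tail: "omit i (z \<circ> Suc) = omit (Suc i) z \<circ> Suc" for i and z :: "nat \<Rightarrow> 'v"
    by (auto simp: omit_def fun_eq_iff)
  have upd_tail: "(\<alpha> \<circ> (x \<circ> Suc))(j := v) = (\<alpha> \<circ> x)(Suc j := v) \<circ> Suc" for j v
    by (auto simp: fun_eq_iff)
  have "br ((\<alpha> ^^ q) ((x \<circ> Suc) i)) (hat f (omit i (x \<circ> Suc))) -
        (\<Sum>j = Suc i..q + 1. hat f (omit i ((\<alpha> \<circ> (x \<circ> Suc))(j := br ((x \<circ> Suc) i) ((x \<circ> Suc) j))))) =
      ?T (Suc i)" for i
    unfolding upd_tail omit_tail hat_tail[OF f]
    by (simp add: sum.shift_bounds_cl_Suc_ivl[of _ "Suc i" "Suc q"] del: sum.cl_ivl_Suc)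
  then have expansion: "coboundary q (q + 1) (\<lambda>r. hat f) (x \<circ> Suc) =
     (\<Sum>i<q + 1. scale ((- 1) ^ Suc i) (?T (Suc i))) + scale ((- 1) ^ (q + 1)) (br (f x) ((\<alpha> ^^ q) (x (q + 2))))"
    unfolding coboundary_eq by (simp add: hat_tail[OF f] del: sum.lessThan_Suc sum.cl_ivl_Suc)
  have "balavoine_bracket scale \<alpha> 1 q (bracket_cochain br) f x =
      br (f x) ((\<alpha> ^^ q) (x (q + 2))) + scale ((- 1) ^ q) (\<Sum>i = 1..q + 1. scale ((- 1) ^ (i - 1)) (?T i))"
  proof -
    have "circ scale \<alpha> 1 q (bracket_cochain br) f x = br (f x) ((\<alpha> ^^ q) (x (q + 2))) +
        scale ((- 1) ^ q) (\<Sum>i = 1..q + 1. scale ((- 1) ^ (i - 1)) (br ((\<alpha> ^^ q) (x i)) (f (omit i x))))"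
      using partial_comp_br_1[OF f, of x] partial_comp_br_2[OF f, of x]
      by (simp add: circ_def numeral_2_eq_2 del: sum.cl_ivl_Suc) (simp add: numeral_2_eq_2)
    then show ?thesis
      unfolding balavoine_bracket_def circ_of_br
      by (simp add: scale_right_diff_distrib sum_subtractf del: sum.cl_ivl_Suc)
  qed
  also have "(\<Sum>i = 1..q + 1. scale ((- 1) ^ (i - 1)) (?T i)) =
      - (\<Sum>i<q + 1. scale ((- 1) ^ Suc i) (?T (Suc i)))"
    by (simp add: sum.atLeast1_atMost_eq sum_negf del: sum.lessThan_Suc sum.cl_ivl_Suc)
  also have "br (f x) ((\<alpha> ^^ q) (x (q + 2))) +
      scale ((- 1) ^ q) (- (\<Sum>i<q + 1. scale ((- 1) ^ Suc i) (?T (Suc i)))) =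
     scale ((- 1) ^ (q + 1)) (coboundary q (q + 1) (\<lambda>r. hat f) (x \<circ> Suc))"
  proof -
    \<comment> \<open>Applied with \<open>c = (- 1) ^ q\<close>, where \<open>- c\<close> is the
      sign in the claim.\<close>
    have "b + scale c (- S) = scale (- c) (S + scale (- c) b)" if "c * c = 1" for b c S
      using that by (simp add: scale_right_diff_distrib)
    moreover have "(- 1 :: 'k) ^ q * (- 1) ^ q = 1"
      by (simp flip: power_mult_distrib)
    moreover have "(- 1 :: 'k) ^ (q + 1) = - ((- 1) ^ q)"
      by simp
    ultimately show ?thesis
      unfolding expansion by (simp only:)
  qed
  finally show ?thesis .
qed

section \<open>Closure and bilinearity\<close>

lemma linear_iff_lincomb:
  "Vector_Spaces.linear scale scale g \<longleftrightarrow>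
     (\<forall>a b u v. g (scale a u + scale b v) = scale a (g u) + scale b (g v))" (is "?L \<longleftrightarrow> ?R")
proof
  assume ?L
  then show ?R by (simp add: Vector_Spaces.linear_iff)
next
  assume r: ?R
  have "g (u + v) = g u + g v" for u v
    using r[rule_format, of 1 u 1 v] by simp
  moreover have "g (scale a u) = scale a (g u)" for a u
    using r[rule_format, of a u 0 u] by simp
  ultimately show ?L
    by (simp add: Vector_Spaces.linear_iff vector_space_axioms)
qed

lemma multilinear_upd:
  assumes "f \<in> multilinear_maps scale n" "t \<in> {1..n}"
  shows "f (w(t := scale a u + scale b v)) = scale a (f (w(t := u))) + scale b (f (w(t := v)))"
  using assms unfolding multilinear_maps_def linear_iff_lincomb by blast

text \<open>Freezing the other slots at their values for \<open>v = 0\<close> reduces the claim to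
  linearity of \<open>f\<close> in slot \<open>t\<close>. It treats nested expressions in which a
  variable passes through a single slot.\<close>

lemma multilinear_maps_linear_slot:
  assumes f: "f \<in> multilinear_maps scale n" and t: "t \<in> {1..n}"
    and lin: "Vector_Spaces.linear scale scale (\<lambda>v. w v t)"
    and const: "\<And>i v v'. i \<in> {1..n} \<Longrightarrow> i \<noteq> t \<Longrightarrow> w v i = w v' i"
  shows "Vector_Spaces.linear scale scale (\<lambda>v. f (w v))"
proof -
  have "f (w v) = f ((w 0)(t := w v t))" for v
    by (rule multilinear_maps_cong[OF f]) (auto intro: const)
  then show ?thesis
    using lin unfolding linear_iff_lincomb by (simp add: multilinear_upd[OF f t])
qed

lemma alpha_lincomb: "\<alpha> (scale a u + scale b v) = scale a (\<alpha> u) + scale b (\<alpha> v)"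
  by (simp add: alpha_add alpha_scale)

lemma linear_alpha_pow: "Vector_Spaces.linear scale scale (\<alpha> ^^ q)"
  unfolding linear_iff_lincomb by (induction q) (simp_all add: alpha_lincomb)

lemma multilinear_maps_lincomb:
  assumes "f \<in> multilinear_maps scale n" "g \<in> multilinear_maps scale n"
  shows "(\<lambda>x. scale a (f x) + scale b (g x)) \<in> multilinear_maps scale n"
  unfolding multilinear_maps_def mem_Collect_eq linear_iff_lincomb
proof (intro conjI allI impI ballI)
  fix x y :: "nat \<Rightarrow> 'v"
  assume "\<forall>i\<in>{1..n}. x i = y i"
  then show "scale a (f x) + scale b (g x) = scale a (f y) + scale b (g y)"
    using assms multilinear_maps_cong by metis
next
  fix x i c d u v
  assume "i \<in> {1..n}"
  then show "scale a (f (x(i := scale c u + scale d v))) + scale b (g (x(i := scale c u + scale d v))) =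
      scale c (scale a (f (x(i := u))) + scale b (g (x(i := u)))) +
      scale d (scale a (f (x(i := v))) + scale b (g (x(i := v))))"
    by (simp add: multilinear_upd[OF assms(1)] multilinear_upd[OF assms(2)] scale_right_distrib
        algebra_simps)
qed

lemma cochains_lincomb:
  assumes "f \<in> cochains scale \<alpha> n" "g \<in> cochains scale \<alpha> n"
  shows "(\<lambda>x. scale a (f x) + scale b (g x)) \<in> cochains scale \<alpha> n"
  using assms multilinear_maps_lincomb unfolding cochains_def by (auto simp: alpha_lincomb)

lemma cochains_zero: "(\<lambda>x. 0) \<in> cochains scale \<alpha> n"
  using alpha_scale[of 0 0] vector_space_axioms
  by (simp add: cochains_def multilinear_maps_def linear_iff_lincomb)

lemma cochains_scale: "f \<in> cochains scale \<alpha> n \<Longrightarrow> (\<lambda>x. scale c (f x)) \<in> cochains scale \<alpha> n"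
  using cochains_lincomb[of f n f c 0] by simp

lemma cochains_add:
  "f \<in> cochains scale \<alpha> n \<Longrightarrow> g \<in> cochains scale \<alpha> n \<Longrightarrow> (\<lambda>x. f x + g x) \<in> cochains scale \<alpha> n"
  using cochains_lincomb[of f n g 1 1] by simp

lemma cochains_diff:
  "f \<in> cochains scale \<alpha> n \<Longrightarrow> g \<in> cochains scale \<alpha> n \<Longrightarrow> (\<lambda>x. f x - g x) \<in> cochains scale \<alpha> n"
  using cochains_lincomb[of f n g 1 "-1"] by simp

lemma cochains_sum:
  "(\<And>a. a \<in> A \<Longrightarrow> h a \<in> cochains scale \<alpha> n) \<Longrightarrow> (\<lambda>x. \<Sum>a\<in>A. h a x) \<in> cochains scale \<alpha> n"
  by (induction A rule: infinite_finite_induct) (simp_all add: cochains_zero cochains_add)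

lemma bracket_cochain_in_cochains: "bracket_cochain br \<in> cochains scale \<alpha> 2"
proof -
  have "Vector_Spaces.linear scale scale (\<lambda>v. bracket_cochain br (x(i := v)))" if "i \<in> {1..2}" for x i
  proof -
    from that consider "i = 1" | "i = 2" by fastforce
    then show ?thesis
      using linear_br_left linear_br_right by cases (simp_all add: bracket_cochain_def)
  qed
  then show ?thesis
    by (auto simp: cochains_def multilinear_maps_def bracket_cochain_def multiplicative)
qed

text \<open>Every argument \<open>x a\<close> enters the nested expression exactly once: through
  \<sigma> if \<open>a < k + q\<close>, as last argument of \<open>Q\<close> if
  \<open>a = k + q\<close>, behind \<open>Q\<close> if \<open>a > k + q\<close>. Linearity is
  checked in these three cases.\<close>

lemma shuffle_term_in_cochains:
  assumes P: "P \<in> cochains scale \<alpha> (p + 1)" and Q: "Q \<in> cochains scale \<alpha> (q + 1)"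
    and k: "k \<in> {1..p + 1}" and \<sigma>: "\<sigma> permutes {1..k - 1 + q}"
  shows "(\<lambda>x. P (\<lambda>i. if i < k then (\<alpha> ^^ q) (x (\<sigma> i))
                else if i = k then Q (\<lambda>j. if j \<le> q then x (\<sigma> (k - 1 + j)) else x (k + q))
                else (\<alpha> ^^ q) (x (i + q)))) \<in> cochains scale \<alpha> (p + q + 1)"
    (is "(\<lambda>x. P (?w x)) \<in> _")
proof -
  let ?z = "\<lambda>x j. if j \<le> q then x (\<sigma> (k - 1 + j)) else x (k + q)"
  have PM: "P \<in> multilinear_maps scale (p + 1)" and QM: "Q \<in> multilinear_maps scale (q + 1)"
    using P Q by (auto simp: cochains_def)
  have \<sigma>_range: "\<sigma> i \<in> {1..k - 1 + q}" if "i \<in> {1..k - 1 + q}" for i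
    using permutes_in_image[OF \<sigma>] that by blast
  have dep: "P (?w x) = P (?w y)" if eq: "\<forall>i\<in>{1..p + q + 1}. x i = y i" for x y
  proof (rule multilinear_maps_cong[OF PM])
    have eq': "x (\<sigma> i) = y (\<sigma> i)" if "i \<in> {1..k - 1 + q}" for i
      using \<sigma>_range[OF that] k eq by auto
    have "?z x j = ?z y j" if "j \<in> {1..q + 1}" for j
    proof (cases "j \<le> q")
      case True
      then have "k - 1 + j \<in> {1..k - 1 + q}" using that by auto
      then show ?thesis using True eq' by simp
    qed (use k eq in auto)
    then have "Q (?z x) = Q (?z y)"
      by (rule multilinear_maps_cong[OF QM])
    then show "?w x i = ?w y i" if "i \<in> {1..p + 1}" for i
      using that k eq eq'[of i] by auto
  qed
  have lin: "Vector_Spaces.linear scale scale (\<lambda>v. P (?w (x(a := v))))"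
    if a: "a \<in> {1..p + q + 1}" for x a
  proof -
    have id: "Vector_Spaces.linear scale scale (\<lambda>v. v)"
      by (simp add: linear_iff_lincomb)
    have Q_const: "Q (?z (x(a := v))) = Q (?z (x(a := v')))"
      if "\<And>j. j \<in> {1..q} \<Longrightarrow> \<sigma> (k - 1 + j) \<noteq> a" "k + q \<noteq> a" for v v'
      by (rule multilinear_maps_cong[OF QM]) (use that in auto)
    consider "a < k + q" | "a = k + q" | "a > k + q" by linarith
    then show ?thesis
    proof cases
      case 1
      \<comment> \<open>The place at which \<sigma> reads \<open>x a\<close>: slot \<open>t\<close>
        of \<open>P\<close> if \<open>t < k\<close>, otherwise slot \<open>t - (k - 1)\<close> of
        \<open>Q\<close>.\<close>
      define t where "t = inv \<sigma> a"
      have \<sigma>t: "\<sigma> i = a \<longleftrightarrow> i = t" for i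
        unfolding t_def using permutes_inverses[OF \<sigma>] by metis
      have "a \<in> {1..k - 1 + q}" using 1 a k by auto
      then have t: "t \<in> {1..k - 1 + q}"
        unfolding t_def using permutes_in_image[OF permutes_inv[OF \<sigma>]] by blast
      show ?thesis
      proof (cases "t < k")
        case True
        then have "k - 1 + j \<noteq> t" if "j \<in> {1..q}" for j
          using that k by auto
        then show ?thesis
          by (intro multilinear_maps_linear_slot[OF PM, of t])
            (use 1 True t k linear_alpha_pow Q_const in \<open>auto simp: \<sigma>t\<close>)
      next
        case False
        then obtain j where j: "t = k - 1 + j" "j \<in> {1..q}"
          using t k by (intro that[of "t - (k - 1)"]) auto
        then have slot: "(\<lambda>v. ?z (x(a := v)) j) = (\<lambda>v. v)"
          using \<sigma>t[of t] by simp
        have "Vector_Spaces.linear scale scale (\<lambda>v. Q (?z (x(a := v))))"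
          by (rule multilinear_maps_linear_slot[OF QM, of j], use j in simp, unfold slot, rule id)
            (use 1 j in \<open>auto simp: \<sigma>t\<close>)
        then show ?thesis
          by (intro multilinear_maps_linear_slot[OF PM, of k]) (use 1 False t k in \<open>auto simp: \<sigma>t\<close>)
      qed
    next
      case 2
      have \<sigma>a: "\<sigma> i \<noteq> a" if "i \<in> {1..k - 1 + q}" for i
        using \<sigma>_range[OF that] 2 k by auto
      have \<sigma>a': "\<sigma> (k - 1 + j) \<noteq> a" if "j \<in> {1..q}" for j
        using \<sigma>a[of "k - 1 + j"] that by auto
      have "Vector_Spaces.linear scale scale (\<lambda>v. Q (?z (x(a := v))))"
        by (rule multilinear_maps_linear_slot[OF QM, of "q + 1"]) (use 2 \<sigma>a' id in auto)
      then show ?thesis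
        by (intro multilinear_maps_linear_slot[OF PM, of k]) (use 2 k \<sigma>a in auto)
    next
      case 3
      then obtain b where b: "a = b + q" "k < b"
        by (metis add_less_cancel_right le_add2 le_add_diff_inverse2 less_imp_le order_trans)
      have \<sigma>a: "\<sigma> i \<noteq> a" if "i \<in> {1..k - 1 + q}" for i
        using \<sigma>_range[OF that] 3 k by auto
      have \<sigma>a': "\<sigma> (k - 1 + j) \<noteq> a" if "j \<in> {1..q}" for j
        using \<sigma>a[of "k - 1 + j"] that by auto
      have "Q (?z (x(a := v))) = Q (?z (x(a := v')))" for v v'
        by (rule Q_const) (use 3 \<sigma>a' in auto)
      moreover have "(\<lambda>v. ?w (x(a := v)) b) = \<alpha> ^^ q"
        using b by auto
      ultimately show ?thesis
        by (intro multilinear_maps_linear_slot[OF PM, of b])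
          (use 3 k a b \<sigma>a linear_alpha_pow in auto)
    qed
  qed
  have "\<alpha> (P (?w x)) = P (?w (\<lambda>i. \<alpha> (x i)))" for x
  proof -
    have "\<alpha> (Q (?z x)) = Q (\<lambda>j. \<alpha> (?z x j))"
      using Q by (simp add: cochains_def)
    also have "(\<lambda>j. \<alpha> (?z x j)) = ?z (\<lambda>i. \<alpha> (x i))"
      by auto
    finally have "(\<lambda>i. \<alpha> (?w x i)) = ?w (\<lambda>i. \<alpha> (x i))"
      by (auto simp: fun_eq_iff funpow_swap1)
    then show ?thesis
      using P by (simp add: cochains_def)
  qed
  then show ?thesis
    using dep lin unfolding cochains_def multilinear_maps_def by blast
qed

lemma circ_in_cochains:
  assumes "P \<in> cochains scale \<alpha> (p + 1)" "Q \<in> cochains scale \<alpha> (q + 1)"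
  shows "circ scale \<alpha> p q P Q \<in> cochains scale \<alpha> (p + q + 1)"
proof -
  have "partial_comp scale \<alpha> q k P Q \<in> cochains scale \<alpha> (p + q + 1)" if "k \<in> {1..p + 1}" for k
    unfolding partial_comp_def[abs_def]
    by (intro cochains_sum cochains_scale shuffle_term_in_cochains assms that)
      (simp add: shuffle_perms_def)
  then show ?thesis
    unfolding circ_def[abs_def] by (intro cochains_sum cochains_scale)
qed

lemma balavoine_bracket_in_cochains:
  assumes "P \<in> cochains scale \<alpha> (p + 1)" "Q \<in> cochains scale \<alpha> (q + 1)"
  shows "balavoine_bracket scale \<alpha> p q P Q \<in> cochains scale \<alpha> (p + q + 1)"
  unfolding balavoine_bracket_def[abs_def]
  using circ_in_cochains[OF assms] circ_in_cochains[OF assms(2,1)]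
  by (intro cochains_diff cochains_scale) (simp_all add: add.commute)

section \<open>Bilinearity of the bracket\<close>

lemma circ_lincomb_left:
  "circ scale \<alpha> p q (\<lambda>z. scale a (P z) + scale b (P' z)) Q x =
     scale a (circ scale \<alpha> p q P Q x) + scale b (circ scale \<alpha> p q P' Q x)"
  by (simp add: circ_def partial_comp_def scale_right_distrib sum.distrib scale_sum_right
      mult_ac del: sum.cl_ivl_Suc)

lemma circ_lincomb_right:
  assumes P: "P \<in> multilinear_maps scale (p + 1)"
  shows "circ scale \<alpha> p q P (\<lambda>z. scale a (Q z) + scale b (Q' z)) x =
     scale a (circ scale \<alpha> p q P Q x) + scale b (circ scale \<alpha> p q P Q' x)"
proof -
  have pc: "partial_comp scale \<alpha> q k P (\<lambda>z. scale a (Q z) + scale b (Q' z)) x =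
      scale a (partial_comp scale \<alpha> q k P Q x) + scale b (partial_comp scale \<alpha> q k P Q' x)"
    if k: "k \<in> {1..p + 1}" for k
  proof -
    \<comment> \<open>Writing the argument list as an update at \<open>k\<close> exposes the value
      of \<open>Q\<close> to the linearity of \<open>P\<close> in that slot.\<close>
    have upd: "(\<lambda>i. if i < k then A i else if i = k then u else B i) =
        (\<lambda>i. if i < k then A i else B i)(k := u)" for A B and u :: 'v
      by auto
    show ?thesis
      unfolding partial_comp_def upd multilinear_upd[OF P k]
      by (simp add: scale_right_distrib sum.distrib scale_sum_right mult_ac del: fun_upd_apply)
  qed
  have "circ scale \<alpha> p q P (\<lambda>z. scale a (Q z) + scale b (Q' z)) x =
      (\<Sum>k = 1..p + 1. scale ((- 1) ^ ((k - 1) * q))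
        (scale a (partial_comp scale \<alpha> q k P Q x) + scale b (partial_comp scale \<alpha> q k P Q' x)))"
    unfolding circ_def by (rule sum.cong) (simp_all only: pc)
  then show ?thesis
    by (simp add: circ_def scale_right_distrib sum.distrib scale_sum_right mult_ac
        del: sum.cl_ivl_Suc)
qed

lemma balavoine_bracket_lincomb_left:
  assumes "Q \<in> multilinear_maps scale (q + 1)"
  shows "balavoine_bracket scale \<alpha> p q (\<lambda>z. scale a (P z) + scale b (P' z)) Q x =
     scale a (balavoine_bracket scale \<alpha> p q P Q x) + scale b (balavoine_bracket scale \<alpha> p q P' Q x)"
  by (simp add: balavoine_bracket_def circ_lincomb_left circ_lincomb_right[OF assms]
      scale_right_distrib scale_right_diff_distrib scale_left_commute algebra_simps)

lemma balavoine_bracket_lincomb_right: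
  assumes "P \<in> multilinear_maps scale (p + 1)"
  shows "balavoine_bracket scale \<alpha> p q P (\<lambda>z. scale a (Q z) + scale b (Q' z)) x =
     scale a (balavoine_bracket scale \<alpha> p q P Q x) + scale b (balavoine_bracket scale \<alpha> p q P Q' x)"
  by (simp add: balavoine_bracket_def circ_lincomb_left circ_lincomb_right[OF assms]
      scale_right_distrib scale_right_diff_distrib scale_left_commute algebra_simps)

lemma cochain_fam_hat:
  assumes f: "f \<in> cochains scale \<alpha> m"
  shows "cochain_fam m (\<lambda>r. hat f)"
proof -
  have M: "f \<in> multilinear_maps scale m"
    using f by (simp add: cochains_def)
  have "hat f (x(i := u + v)) = hat f (x(i := u)) + hat f (x(i := v))" if "i < m" for x i u v
  proof -
    have "hat f (x(i := w)) = f ((\<lambda>j. x (j - 1))(i + 1 := w))" for w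
      unfolding hat_def by (rule multilinear_maps_cong[OF M]) auto
    then show ?thesis
      using multilinear_upd[OF M, of "i + 1" _ 1 u 1 v] that by simp
  qed
  moreover have "hat f x = hat f y" if "\<forall>i<m. x i = y i" for x y
    unfolding hat_def by (rule multilinear_maps_cong[OF M]) (use that in auto)
  moreover have "\<alpha> (hat f x) = hat f (\<alpha> \<circ> x)" for x
    using f by (simp add: hat_def cochains_def)
  ultimately show ?thesis
    unfolding cochain_fam_def multiadditive_def by blast
qed

text \<open>Both brackets are signed coboundaries, so the claim is \<delta> \<delta> = 0 for the
  constant family of \<open>f\<close>.\<close>

lemma balavoine_bracket_square_zero:
  assumes f: "f \<in> cochains scale \<alpha> (q + 1)"
  shows "balavoine_bracket scale \<alpha> 1 (q + 1) (bracket_cochain br)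
      (balavoine_bracket scale \<alpha> 1 q (bracket_cochain br) f) x = 0"
proof -
  let ?g = "balavoine_bracket scale \<alpha> 1 q (bracket_cochain br) f"
  have M: "f \<in> multilinear_maps scale (q + 1)"
    using f by (simp add: cochains_def)
  have "?g \<in> cochains scale \<alpha> (q + 1 + 1)"
    using balavoine_bracket_in_cochains[OF _ f, of "bracket_cochain br" 1]
      bracket_cochain_in_cochains by (simp add: numeral_2_eq_2)
  then have g: "?g \<in> multilinear_maps scale (q + 1 + 1)"
    by (simp add: cochains_def)
  \<comment> \<open>Valid for every \<open>r\<close>, since shifting a constant family does not
    change it.\<close>
  have "hat ?g z = scale ((- 1) ^ (q + 1)) (coboundary_fam q (q + 1) (\<lambda>r. hat f) r z)" for r z
  proof -
    have "(\<lambda>i. z (i - 1)) \<circ> Suc = z" by auto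
    then show ?thesis
      by (simp only: hat_def[of ?g] balavoine_bracket_eq_coboundary[OF M] coboundary_fam_def shift_def[abs_def])
  qed
  then have hat_g: "(\<lambda>r. hat ?g) = (\<lambda>r z. scale ((- 1) ^ (q + 1)) (coboundary_fam q (q + 1) (\<lambda>r. hat f) r z))"
    by blast
  have dd: "coboundary (q + 1) (q + 1 + 1) (coboundary_fam q (q + 1) (\<lambda>r. hat f)) (x \<circ> Suc) = 0"
    using coboundary_coboundary[OF cochain_fam_hat[OF f], of q "x \<circ> Suc"] by (simp only: Suc_eq_plus1)
  show ?thesis
    unfolding balavoine_bracket_eq_coboundary[OF g] hat_g coboundary_scale dd by simp
qed

end

section \<open>Two compatible products\<close>

context compatible_hom_leibniz
begin

text \<open>The terms with one product used twice match by the two Hom-Leibniz identities, the mixed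
  terms by compatibility.\<close>

lemma sum_hom_leibniz: "hom_leibniz scale (\<lambda>x y. br1 x y + br2 x y) \<alpha>"
proof
  show "br1 (\<alpha> x) (br1 y z + br2 y z) + br2 (\<alpha> x) (br1 y z + br2 y z) =
      br1 (br1 x y + br2 x y) (\<alpha> z) + br2 (br1 x y + br2 x y) (\<alpha> z) +
      (br1 (\<alpha> y) (br1 x z + br2 x z) + br2 (\<alpha> y) (br1 x z + br2 x z))" for x y z
    using first.hom_leibniz_identity[of x y z] second.hom_leibniz_identity[of x y z]
      compatibility[of x y z]
    by (simp add: first.br_add_left second.br_add_left first.br_add_right second.br_add_right
        algebra_simps)
qed (simp_all add: first.linear_alpha first.alpha_add first.alpha_scale first.multiplicative second.multiplicative
    first.linear_iff_lincomb first.br_add_left second.br_add_left first.br_add_right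
    second.br_add_right first.br_scale_left second.br_scale_left first.br_scale_right
    second.br_scale_right first.scale_right_distrib)

abbreviation "B1 q \<equiv> balavoine_bracket scale \<alpha> 1 q (bracket_cochain br1)"
abbreviation "B2 q \<equiv> balavoine_bracket scale \<alpha> 1 q (bracket_cochain br2)"

lemma bracket_cochains_multilinear:
  "bracket_cochain br1 \<in> multilinear_maps scale (1 + 1)"
  "bracket_cochain br2 \<in> multilinear_maps scale (1 + 1)"
  using first.bracket_cochain_in_cochains second.bracket_cochain_in_cochains
  by (simp_all add: cochains_def numeral_2_eq_2)

lemma B_in_cochains:
  assumes "f \<in> cochains scale \<alpha> (q + 1)"
  shows "B1 q f \<in> cochains scale \<alpha> (q + 1 + 1)" "B2 q f \<in> cochains scale \<alpha> (q + 1 + 1)"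
  using first.balavoine_bracket_in_cochains[OF _ assms, of _ 1]
    first.bracket_cochain_in_cochains second.bracket_cochain_in_cochains
  by (simp_all add: numeral_2_eq_2)

text \<open>Polarization: the square of the bracket with the sum product vanishes, as do both
  individual squares, which leaves the cross terms.\<close>

lemma B_anticommute:
  assumes f: "f \<in> cochains scale \<alpha> (q + 1)"
  shows "B1 (q + 1) (B2 q f) x + B2 (q + 1) (B1 q f) x = 0"
proof -
  let ?B = "\<lambda>q. balavoine_bracket scale \<alpha> 1 q (bracket_cochain (\<lambda>x y. br1 x y + br2 x y))"
  have B: "?B r g = (\<lambda>x. B1 r g x + B2 r g x)" if "g \<in> cochains scale \<alpha> (r + 1)" for r g
    using first.balavoine_bracket_lincomb_left[of g r 1 1 "bracket_cochain br1" 1 "bracket_cochain br2"] that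
    by (simp add: cochains_def bracket_cochain_def[abs_def] fun_eq_iff)
  have "?B (q + 1) (?B q f) x = 0"
    by (rule hom_leibniz.balavoine_bracket_square_zero[OF sum_hom_leibniz f])
  then have "B1 (q + 1) (\<lambda>x. B1 q f x + B2 q f x) x + B2 (q + 1) (\<lambda>x. B1 q f x + B2 q f x) x = 0"
    by (simp only: B f B_in_cochains first.cochains_add)
  then show ?thesis
    using first.balavoine_bracket_lincomb_right[OF bracket_cochains_multilinear(1), of "q + 1" 1 "B1 q f" 1 "B2 q f" x]
      first.balavoine_bracket_lincomb_right[OF bracket_cochains_multilinear(2), of "q + 1" 1 "B1 q f" 1 "B2 q f" x]
      first.balavoine_bracket_square_zero[OF f, of x] second.balavoine_bracket_square_zero[OF f, of x]
    by (simp add: add.commute)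
qed

text \<open>Padding with zeros turns the three cases of the differential into a single formula.\<close>

definition extend :: "nat \<Rightarrow> (nat \<Rightarrow> (nat \<Rightarrow> 'v) \<Rightarrow> 'v) \<Rightarrow> nat \<Rightarrow> (nat \<Rightarrow> 'v) \<Rightarrow> 'v" where
  "extend n f i = (if i \<in> {1..n} then f i else (\<lambda>x. 0))"

lemma extend_in_cochains: "f \<in> LC scale \<alpha> n \<Longrightarrow> extend n f i \<in> cochains scale \<alpha> n"
  by (auto simp: LC_def extend_def first.cochains_zero)

lemma B_zero: "B1 q (\<lambda>x. 0) x = 0" "B2 q (\<lambda>x. 0) x = 0"
  using first.balavoine_bracket_lincomb_right[OF bracket_cochains_multilinear(1), of q 0 _ 0]
    first.balavoine_bracket_lincomb_right[OF bracket_cochains_multilinear(2), of q 0 _ 0]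
  by simp_all

text \<open>In the first and last components one summand is a bracket with the padded zero, at index
  0 or \<open>q + 2\<close>.\<close>

lemma compat_d_eq:
  "compat_d scale br1 br2 \<alpha> (q + 1) f = (\<lambda>i\<in>{1..q + 1 + 1}. \<lambda>x.
     scale ((- 1) ^ q) (B2 q (extend (q + 1) f (i - 1)) x + B1 q (extend (q + 1) f i) x))"
  unfolding compat_d_def Let_def add_diff_cancel_right'
proof (rule restrict_ext, goal_cases)
  case (1 i)
  then consider "i = 1" | "i = q + 1 + 1" | "2 \<le> i" "i \<le> q + 1"
    by fastforce
  then show ?case
    by cases (auto simp: extend_def B_zero[unfolded One_nat_def])
qed

lemma extend_compat_d:
  "extend (q + 1 + 1) (compat_d scale br1 br2 \<alpha> (q + 1) f) i = (\<lambda>x.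
     scale ((- 1) ^ q) (B2 q (extend (q + 1) f (i - 1)) x + B1 q (extend (q + 1) f i) x))"
proof (cases "i \<in> {1..q + 1 + 1}")
  case True
  then show ?thesis
    unfolding extend_def[of "q + 1 + 1"] compat_d_eq by simp
next
  case False
  \<comment> \<open>For \<open>i = 0\<close> truncated subtraction leaves \<open>i - 1 = 0\<close>;
    for \<open>i > q + 2\<close> both indices exceed \<open>q + 1\<close>.\<close>
  then have "extend (q + 1) f (i - 1) = (\<lambda>x. 0)" "extend (q + 1) f i = (\<lambda>x. 0)"
    by (auto simp: extend_def)
  then show ?thesis
    unfolding extend_def[of "q + 1 + 1"] using False by (auto simp: B_zero[unfolded One_nat_def])
qed

lemma compat_d_in_LC:
  assumes "f \<in> LC scale \<alpha> (q + 1)"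
  shows "compat_d scale br1 br2 \<alpha> (q + 1) f \<in> LC scale \<alpha> (q + 1 + 1)"
  unfolding LC_def compat_d_eq
  using extend_in_cochains[OF assms] B_in_cochains
  by (auto intro!: first.cochains_scale first.cochains_add restrict_PiE_iff[THEN iffD2])

text \<open>Up to sign, component \<open>i\<close> consists of the square for \<open>br2\<close> on
  entry \<open>i - 2\<close>, the anticommutator on entry \<open>i - 1\<close> and the square for
  \<open>br1\<close> on entry \<open>i\<close>; each of them vanishes.\<close>

lemma compat_d_compat_d:
  assumes f: "f \<in> LC scale \<alpha> (q + 1)"
  shows "compat_d scale br1 br2 \<alpha> (q + 1 + 1) (compat_d scale br1 br2 \<alpha> (q + 1) f) = LC_zero (q + 1 + 1 + 1)"
proof -
  let ?e = "extend (q + 1) f"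
  have lincomb: "B (\<lambda>x. scale c (g x + h x)) x = scale c (B g x + B h x)"
    if "B \<in> {B1 (q + 1), B2 (q + 1)}" for B c g h x
    using that
      first.balavoine_bracket_lincomb_right[OF bracket_cochains_multilinear(1), of "q + 1" c g c h x]
      first.balavoine_bracket_lincomb_right[OF bracket_cochains_multilinear(2), of "q + 1" c g c h x]
    by (auto simp: first.scale_right_distrib)
  have "B2 (q + 1) (extend (q + 1 + 1) (compat_d scale br1 br2 \<alpha> (q + 1) f) (i - 1)) x +
      B1 (q + 1) (extend (q + 1 + 1) (compat_d scale br1 br2 \<alpha> (q + 1) f) i) x = 0" for i x
  proof -
    have "B2 (q + 1) (B2 q (?e (i - 1 - 1))) x = 0" "B1 (q + 1) (B1 q (?e i)) x = 0"
      "B1 (q + 1) (B2 q (?e (i - 1))) x + B2 (q + 1) (B1 q (?e (i - 1))) x = 0"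
      using extend_in_cochains[OF f] first.balavoine_bracket_square_zero
        second.balavoine_bracket_square_zero B_anticommute by blast+
    then show ?thesis
      unfolding extend_compat_d
      by (simp add: lincomb add.commute flip: first.scale_right_distrib)
  qed
  then show ?thesis
    unfolding LC_zero_def compat_d_eq[of "q + 1"] by (auto intro!: restrict_ext)
qed

end

theorem theorem4p1:
  fixes scale :: "'k::field_char_0 \<Rightarrow> 'v::ab_group_add \<Rightarrow> 'v"
    and br1 br2 :: "'v \<Rightarrow> 'v \<Rightarrow> 'v" and \<alpha> :: "'v \<Rightarrow> 'v" and n :: nat
  assumes "compatible_hom_leibniz scale br1 br2 \<alpha>"
    and "n \<ge> 1"
  shows "compat_d scale br1 br2 \<alpha> n \<in> LC scale \<alpha> n \<rightarrow> LC scale \<alpha> (n + 1) \<and>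
         (\<forall>f\<in>LC scale \<alpha> n.
            compat_d scale br1 br2 \<alpha> (n + 1) (compat_d scale br1 br2 \<alpha> n f) = LC_zero (n + 2))"
proof -
  obtain q where "n = q + 1"
    using \<open>n \<ge> 1\<close> by (metis add.commute le_Suc_ex)
  then show ?thesis
    using compatible_hom_leibniz.compat_d_in_LC[OF assms(1), of _ q]
      compatible_hom_leibniz.compat_d_compat_d[OF assms(1), of _ q]
    by (simp add: numeral_2_eq_2)
qed

end
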